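(* Let $f,g\colon(\mathbb{R}^n,0)\to(\mathbb{R},0)$ be germs of $C^\infty$ functions. Suppose that $\mathrm{in}(f)$ has an algebraically isolated singularity at the origin. If $f$ and $g$ are $\mathcal{R}$-$C^1$ equivalent, then $\mu(f)=\mu(g)$.
   Context: Milnor number: let $\mathcal{E}_n$ be the $\mathbb{R}$-algebra of germs at $0$ of $C^\infty$ functions $(\mathbb{R}^n,0)\to\mathbb{R}$. For $f\in\mathcal{E}_n$, $J(f)$ is the ideal of $\mathcal{E}_n$ generated by $\frac{\partial f}{\partial x_1},\dots,\frac{\partial f}{\partial x_n}$, and $\mu(f)=\dim_{\mathbb{R}}\mathcal{E}_n/J(f)\in\mathbb{N}\cup\{+\infty\}$. One says that $f$ has an algebraically isolated singularity at the origin if $\mu(f)<+\infty$. Initial part: for a $C^\infty$ germ $f$ with $f(0)=0$ and nonzero Taylor series at $0$, $\mathrm{in}(f)$ is the lowest-degree nonzero homogeneous component of the Taylor series of $f$ at $0$. The hypothesis on $\mathrm{in}(f)$ includes that it exists. $f$ and $g$ are $\mathcal{R}$-$C^1$ equivalent if there is a germ of $C^1$ diffeomorphism $\phi\colon(\mathbb{R}^n,0)\to(\mathbb{R}^n,0)$ with $f=g\circ\phi$. *)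

theory Defs
  imports "HOL-Analysis.Analysis"
begin

text \<open>Intended for open \<open>U\<close> only: the derivatives are taken in the whole space.\<close>

primrec C_k_on :: "nat \<Rightarrow> ('a::euclidean_space \<Rightarrow> 'b::real_normed_vector) \<Rightarrow> 'a set \<Rightarrow> bool" where
  "C_k_on 0 f U \<longleftrightarrow> continuous_on U f"
| "C_k_on (Suc k) f U \<longleftrightarrow>
     (\<forall>x\<in>U. f differentiable at x) \<and>
     (\<forall>v. C_k_on k (\<lambda>x. frechet_derivative f (at x) v) U)"

lemma C_k_on_cong:
  assumes "open U" "\<And>x. x \<in> U \<Longrightarrow> f x = g x"
  shows "C_k_on k f U \<longleftrightarrow> C_k_on k g U"
  using assms(2)
proof (induction k arbitrary: f g)
  case 0
  then show ?case by (simp cong: continuous_on_cong)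
next
  case (Suc k)
  have imp: "g differentiable at x \<and> frechet_derivative f (at x) = frechet_derivative g (at x)"
    if x: "x \<in> U" and fg: "\<And>x. x \<in> U \<Longrightarrow> f x = g x" and d: "f differentiable at x"
    for x and f g :: "'a \<Rightarrow> 'b"
  proof
    show "g differentiable at x"
      using d has_derivative_transform_within_open[of f _ x UNIV U g] \<open>open U\<close> x fg
      unfolding differentiable_def by metis
    show "frechet_derivative f (at x) = frechet_derivative g (at x)"
      using frechet_derivative_transform_within_open[OF d \<open>open U\<close> x] fg by metis
  qed
  have fg: "f x = g x" "g x = f x" if "x \<in> U" for x using Suc.prems[OF that] by auto
  show ?case
  proof
    assume L: "C_k_on (Suc k) f U"
    then have *: "g differentiable at x \<and> frechet_derivative f (at x) = frechet_derivative g (at x)"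
      if "x \<in> U" for x using imp[OF that fg(1)] that by auto
    have "C_k_on k (\<lambda>x. frechet_derivative f (at x) v) U = C_k_on k (\<lambda>x. frechet_derivative g (at x) v) U" for v
      by (rule Suc.IH) (simp add: *)
    with L * show "C_k_on (Suc k) g U" by simp
  next
    assume L: "C_k_on (Suc k) g U"
    then have *: "f differentiable at x \<and> frechet_derivative g (at x) = frechet_derivative f (at x)"
      if "x \<in> U" for x using imp[OF that fg(2)] that by auto
    have "C_k_on k (\<lambda>x. frechet_derivative f (at x) v) U = C_k_on k (\<lambda>x. frechet_derivative g (at x) v) U" for v
      by (rule Suc.IH) (simp add: *)
    with L * show "C_k_on (Suc k) f U" by simp
  qed
qed

lemma C_k_on_subset: "C_k_on k f U \<Longrightarrow> V \<subseteq> U \<Longrightarrow> C_k_on k f V"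
  by (induction k arbitrary: f) (auto intro: continuous_on_subset)

lemma C_k_on_SucD: "C_k_on (Suc k) f U \<Longrightarrow> C_k_on k f U"
proof (induction k arbitrary: f)
  case 0
  then show ?case
    by (auto intro!: continuous_at_imp_continuous_on differentiable_imp_continuous_within)
qed auto

lemma C_k_on_const: "C_k_on k (\<lambda>x. c) U"
  by (induction k arbitrary: c) auto

lemma C_k_on_linear:
  assumes "bounded_linear f" shows "C_k_on k f U"
proof (cases k)
  case 0
  then show ?thesis using assms by (simp add: linear_continuous_on)
next
  case (Suc k')
  have "frechet_derivative f (at x) = f" for x
    using frechet_derivative_at[OF bounded_linear_imp_has_derivative[OF assms]] by metis
  then show ?thesis
    using Suc bounded_linear_imp_differentiable[OF assms] by (simp add: C_k_on_const)
qed

lemma C_k_on_add: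
  assumes "open U" shows "C_k_on k f U \<Longrightarrow> C_k_on k g U \<Longrightarrow> C_k_on k (\<lambda>x. f x + g x) U"
proof (induction k arbitrary: f g)
  case 0
  then show ?case by (simp add: continuous_on_add)
next
  case (Suc k)
  have "frechet_derivative (\<lambda>x. f x + g x) (at x) v =
      frechet_derivative f (at x) v + frechet_derivative g (at x) v" if "x \<in> U" for x v
  proof -
    have "((\<lambda>x. f x + g x) has_derivative
       (\<lambda>v. frechet_derivative f (at x) v + frechet_derivative g (at x) v)) (at x)"
      using Suc.prems that by (intro has_derivative_add) (simp_all flip: frechet_derivative_works)
    from frechet_derivative_at[OF this] show ?thesis by metis
  qed
  then have "C_k_on k (\<lambda>x. frechet_derivative (\<lambda>x. f x + g x) (at x) v) U" for v
    using C_k_on_cong[OF assms, of "\<lambda>x. frechet_derivative (\<lambda>x. f x + g x) (at x) v"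
        "\<lambda>x. frechet_derivative f (at x) v + frechet_derivative g (at x) v"]
      Suc.IH Suc.prems by auto
  with Suc.prems show ?case by (auto intro: differentiable_add)
qed

lemma C_k_on_mult:
  fixes f g :: "'a::euclidean_space \<Rightarrow> real"
  assumes "open U" shows "C_k_on k f U \<Longrightarrow> C_k_on k g U \<Longrightarrow> C_k_on k (\<lambda>x. f x * g x) U"
proof (induction k arbitrary: f g)
  case 0
  then show ?case by (simp add: continuous_on_mult)
next
  case (Suc k)
  have "frechet_derivative (\<lambda>x. f x * g x) (at x) v =
      f x * frechet_derivative g (at x) v + frechet_derivative f (at x) v * g x" if "x \<in> U" for x v
  proof -
    have "((\<lambda>x. f x * g x) has_derivative
       (\<lambda>v. f x * frechet_derivative g (at x) v + frechet_derivative f (at x) v * g x)) (at x)"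
      using Suc.prems that by (intro has_derivative_mult) (simp_all flip: frechet_derivative_works)
    from frechet_derivative_at[OF this] show ?thesis by metis
  qed
  moreover have "C_k_on k (\<lambda>x. f x * frechet_derivative g (at x) v + frechet_derivative f (at x) v * g x) U" for v
    using Suc.prems C_k_on_SucD by (intro C_k_on_add[OF assms] Suc.IH) auto
  ultimately have "C_k_on k (\<lambda>x. frechet_derivative (\<lambda>x. f x * g x) (at x) v) U" for v
    using C_k_on_cong[OF assms, of "\<lambda>x. frechet_derivative (\<lambda>x. f x * g x) (at x) v"
        "\<lambda>x. f x * frechet_derivative g (at x) v + frechet_derivative f (at x) v * g x"]
     by blast
  with Suc.prems show ?case by (auto intro: differentiable_mult)
qed

definition smooth_near_0 :: "(real^'n::finite \<Rightarrow> real) \<Rightarrow> bool" where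
  "smooth_near_0 f \<longleftrightarrow> (\<exists>U. open U \<and> 0 \<in> U \<and> (\<forall>k. C_k_on k f U))"

definition germ_rel :: "(real^'n::finite \<Rightarrow> real) \<Rightarrow> (real^'n \<Rightarrow> real) \<Rightarrow> bool" where
  "germ_rel f g \<longleftrightarrow> smooth_near_0 f \<and> smooth_near_0 g \<and> (\<forall>\<^sub>F x in nhds 0. f x = g x)"

lemma smooth_near_0_const: "smooth_near_0 (\<lambda>x. c)"
  unfolding smooth_near_0_def using C_k_on_const open_UNIV by blast

lemma smooth_near_0_nth: "smooth_near_0 (\<lambda>x. x $ i)"
  unfolding smooth_near_0_def using C_k_on_linear[OF bounded_linear_vec_nth] open_UNIV by blast

lemma smooth_near_0_binop:
  assumes "smooth_near_0 f" "smooth_near_0 g"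
    and "\<And>U k. open U \<Longrightarrow> C_k_on k f U \<Longrightarrow> C_k_on k g U \<Longrightarrow> C_k_on k h U"
  shows "smooth_near_0 h"
proof -
  obtain U V where "open U" "0 \<in> U" "\<And>k. C_k_on k f U" "open V" "0 \<in> V" "\<And>k. C_k_on k g V"
    using assms(1,2) unfolding smooth_near_0_def by blast
  then show ?thesis
    unfolding smooth_near_0_def
    by (intro exI[of _ "U \<inter> V"]) (auto intro!: assms(3) intro: C_k_on_subset)
qed

lemma smooth_near_0_add: "smooth_near_0 f \<Longrightarrow> smooth_near_0 g \<Longrightarrow> smooth_near_0 (\<lambda>x. f x + g x)"
  by (erule (1) smooth_near_0_binop) (rule C_k_on_add)

lemma smooth_near_0_mult: "smooth_near_0 f \<Longrightarrow> smooth_near_0 g \<Longrightarrow> smooth_near_0 (\<lambda>x. f x * g x)"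
  by (erule (1) smooth_near_0_binop) (rule C_k_on_mult)

lemma smooth_near_0_uminus: "smooth_near_0 f \<Longrightarrow> smooth_near_0 (\<lambda>x. - f x)"
  using smooth_near_0_mult[OF smooth_near_0_const[of "-1"]] by force

lemma smooth_near_0_minus: "smooth_near_0 f \<Longrightarrow> smooth_near_0 g \<Longrightarrow> smooth_near_0 (\<lambda>x. f x - g x)"
  using smooth_near_0_add[OF _ smooth_near_0_uminus] by force

lemma part_equivp_germ_rel: "part_equivp (germ_rel :: (real^'n::finite \<Rightarrow> real) \<Rightarrow> _)"
proof (rule part_equivpI)
  show "\<exists>f :: real^'n \<Rightarrow> real. germ_rel f f"
    using smooth_near_0_const unfolding germ_rel_def by auto
  show "symp (germ_rel :: (real^'n \<Rightarrow> real) \<Rightarrow> _)"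
    by (auto intro!: sympI simp: germ_rel_def eq_commute)
  show "transp (germ_rel :: (real^'n \<Rightarrow> real) \<Rightarrow> _)"
    unfolding germ_rel_def by (intro transpI conjI; elim conjE; (assumption | erule (1) eventually_elim2, simp))
qed

quotient_type 'n germ = "real^'n::finite \<Rightarrow> real" / partial: germ_rel
  by (rule part_equivp_germ_rel)

instantiation germ :: (finite) "{comm_ring_1, real_algebra_1}"
begin

lift_definition zero_germ :: "'a germ" is "\<lambda>x. 0"
  by (simp add: germ_rel_def smooth_near_0_const)

lift_definition one_germ :: "'a germ" is "\<lambda>x. 1"
  by (simp add: germ_rel_def smooth_near_0_const)

lift_definition plus_germ :: "'a germ \<Rightarrow> 'a germ \<Rightarrow> 'a germ" is "\<lambda>f g x. f x + g x"
  by (auto simp: germ_rel_def smooth_near_0_add elim: eventually_elim2)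

lift_definition minus_germ :: "'a germ \<Rightarrow> 'a germ \<Rightarrow> 'a germ" is "\<lambda>f g x. f x - g x"
  by (auto simp: germ_rel_def smooth_near_0_minus elim: eventually_elim2)

lift_definition uminus_germ :: "'a germ \<Rightarrow> 'a germ" is "\<lambda>f x. - f x"
  by (auto simp: germ_rel_def smooth_near_0_uminus elim: eventually_mono)

lift_definition times_germ :: "'a germ \<Rightarrow> 'a germ \<Rightarrow> 'a germ" is "\<lambda>f g x. f x * g x"
  by (auto simp: germ_rel_def smooth_near_0_mult elim: eventually_elim2)

lift_definition scaleR_germ :: "real \<Rightarrow> 'a germ \<Rightarrow> 'a germ" is "\<lambda>c f x. c * f x"
  by (auto simp: germ_rel_def smooth_near_0_mult smooth_near_0_const elim: eventually_mono)

instance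
proof
  show "(0::'a germ) \<noteq> 1"
    by transfer (auto simp: germ_rel_def dest: eventually_nhds_x_imp_x)
qed (transfer; force simp: germ_rel_def algebra_simps
      intro!: smooth_near_0_const smooth_near_0_add smooth_near_0_mult smooth_near_0_minus smooth_near_0_uminus)+

end

lift_definition germ_value :: "'n::finite germ \<Rightarrow> real" is "\<lambda>f. f 0"
  by (auto simp: germ_rel_def dest: eventually_nhds_x_imp_x)

lift_definition germ_coord :: "'n::finite \<Rightarrow> 'n germ" is "\<lambda>i x. x $ i"
  by (simp add: germ_rel_def smooth_near_0_nth)

lift_definition germ_partial :: "'n::finite \<Rightarrow> 'n germ \<Rightarrow> 'n germ"
  is "\<lambda>i f x. frechet_derivative f (at x) (axis i 1)"
proof -
  fix i :: 'n and f g :: "real^'n \<Rightarrow> real"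
  let ?D = "\<lambda>f x. frechet_derivative f (at x) (axis i 1) :: real"
  assume *: "germ_rel f g"
  have smooth: "smooth_near_0 (?D h)" if h: "smooth_near_0 h" for h
  proof -
    obtain U where U: "open U" "0 \<in> U" "\<And>k. C_k_on (Suc k) h U"
      using h unfolding smooth_near_0_def by blast
    then have "C_k_on k (?D h) U" for k using U(3)[of k] by simp
    with U show ?thesis unfolding smooth_near_0_def by blast
  qed
  obtain U where U: "open U" "0 \<in> U" "\<And>k. C_k_on k f U"
    using * unfolding germ_rel_def smooth_near_0_def by blast
  obtain V where V: "open V" "0 \<in> V" "\<And>x. x \<in> V \<Longrightarrow> f x = g x"
    using * unfolding germ_rel_def eventually_nhds by blast
  have "?D f x = ?D g x" if "x \<in> U \<inter> V" for x
  proof -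
    have "f differentiable at x" using U(3)[of "Suc 0"] that by simp
    from frechet_derivative_transform_within_open[OF this V(1)] that V(3)
    show ?thesis by (metis IntD2)
  qed
  then have "\<forall>\<^sub>F x in nhds 0. ?D f x = ?D g x"
    unfolding eventually_nhds using U V by (intro exI[of _ "U \<inter> V"]) auto
  with * smooth show "germ_rel (?D f) (?D g)" by (simp add: germ_rel_def)
qed

text \<open>The ideal generated by \<open>S\<close> is the submodule it spans in the ring, seen as a module over itself.\<close>

definition ideal_generated :: "'a::comm_ring_1 set \<Rightarrow> 'a set" where
  "ideal_generated S = module.span (*) S"

definition jacobian_ideal :: "'n::finite germ \<Rightarrow> 'n germ set" where
  "jacobian_ideal f = ideal_generated (range (\<lambda>i. germ_partial i f))"

text \<open>The classes of the elements of the finite set \<open>B\<close> are pairwise distinct and form a basis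
  of the quotient by the subspace \<open>W\<close> of the whole space.\<close>

definition quotient_basis :: "'a::real_vector set \<Rightarrow> 'a set \<Rightarrow> bool" where
  "quotient_basis W B \<longleftrightarrow> finite B \<and>
     (\<forall>c. (\<Sum>b\<in>B. c b *\<^sub>R b) \<in> W \<longrightarrow> (\<forall>b\<in>B. c b = 0)) \<and>
     (\<forall>v. \<exists>c. v - (\<Sum>b\<in>B. c b *\<^sub>R b) \<in> W)"

text \<open>All finite bases of a quotient have the same cardinality (see below), so the infimum is
  just that cardinality, and it is \<open>\<infinity>\<close> if there is no finite basis.\<close>

definition quotient_dim :: "'a::real_vector set \<Rightarrow> enat" where
  "quotient_dim W = Inf {enat (card B) | B. quotient_basis W B}"

lemma quotient_basis_card_le:
  assumes W: "subspace W" and A: "quotient_basis W A" and B: "quotient_basis W B"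
  shows "card A \<le> card B"
proof -
  have fin: "finite A" "finite B" using A B by (auto simp: quotient_basis_def)
  have "\<forall>v. \<exists>c. v - (\<Sum>b\<in>B. c b *\<^sub>R b) \<in> W" using B by (auto simp: quotient_basis_def)
  then obtain c where c: "\<And>v. v - (\<Sum>b\<in>B. c v b *\<^sub>R b) \<in> W" by metis
  define P where "P v = (\<Sum>b\<in>B. c v b *\<^sub>R b)" for v
  have key: "k a = 0" if k: "(\<Sum>a\<in>A. k a *\<^sub>R P a) = 0" and a: "a \<in> A" for k a
  proof -
    have "(\<Sum>a\<in>A. k a *\<^sub>R (a - P a)) \<in> W"
      using c W by (auto simp: P_def intro!: subspace_sum subspace_scale)
    then have "(\<Sum>a\<in>A. k a *\<^sub>R a) \<in> W"
      using k by (simp add: scaleR_diff_right sum_subtractf)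
    then show ?thesis using A a by (auto simp: quotient_basis_def)
  qed
  have inj: "inj_on P A"
  proof (rule inj_onI, rule ccontr)
    fix a a' assume a: "a \<in> A" "a' \<in> A" "P a = P a'" "a \<noteq> a'"
    let ?k = "\<lambda>x. if x = a then 1 else if x = a' then -1 else 0 :: real"
    have "(\<Sum>x\<in>A. ?k x *\<^sub>R P x) = (\<Sum>x\<in>{a, a'}. ?k x *\<^sub>R P x)"
      using a fin by (intro sum.mono_neutral_right) auto
    also have "\<dots> = 0" using a by simp
    finally show False using key[of ?k a] a by simp
  qed
  have "independent (P ` A)"
  proof (rule independent_if_scalars_zero)
    fix k x assume k: "(\<Sum>x\<in>P ` A. k x *\<^sub>R x) = 0" and "x \<in> P ` A"
    then obtain a where a: "a \<in> A" "x = P a" by blast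
    from k have "(\<Sum>a\<in>A. (k \<circ> P) a *\<^sub>R P a) = 0" by (simp add: sum.reindex[OF inj])
    from key[OF this a(1)] a show "k x = 0" by simp
  qed (use fin in auto)
  moreover have "P ` A \<subseteq> span B"
    unfolding P_def by (intro image_subsetI span_sum span_scale span_base)
  ultimately have "card (P ` A) \<le> card B"
    using independent_span_bound[OF fin(2)] by blast
  then show ?thesis by (simp add: card_image[OF inj])
qed

lemma quotient_dim_eq_card:
  assumes "subspace W" "quotient_basis W B"
  shows "quotient_dim W = enat (card B)"
proof -
  have "{enat (card A) | A. quotient_basis W A} = {enat (card B)}"
    using assms quotient_basis_card_le[OF assms(1)] by (auto intro: antisym)
  then show ?thesis by (simp add: quotient_dim_def)
qed

definition milnor_number :: "'n::finite germ \<Rightarrow> enat" where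
  "milnor_number f = quotient_dim (jacobian_ideal f)"

definition alg_isolated_singularity :: "'n::finite germ \<Rightarrow> bool" where
  "alg_isolated_singularity f \<longleftrightarrow> milnor_number f < \<infinity>"

text \<open>Homogeneous component of degree \<open>d\<close> of the Taylor series at \<open>0\<close>, regarded as a germ:
  \<open>1/d! \<Sum>\<^bsub>i\<^sub>1,\<dots>,i\<^sub>d\<^esub> (\<partial>\<^bsub>i\<^sub>1\<^esub> \<dots> \<partial>\<^bsub>i\<^sub>d\<^esub> f)(0) x\<^bsub>i\<^sub>1\<^esub> \<dots> x\<^bsub>i\<^sub>d\<^esub>\<close>.
  A multi-index \<open>\<alpha>\<close> of degree \<open>d\<close> is hit by \<open>d!/\<alpha>!\<close> words, so this is the sum of the terms
  \<open>\<partial>\<^sup>\<alpha> f(0) x\<^sup>\<alpha> / \<alpha>!\<close>.\<close>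

definition taylor_component :: "nat \<Rightarrow> 'n::finite germ \<Rightarrow> 'n germ" where
  "taylor_component d f =
     (\<Sum>is | length is = d.
        (germ_value (foldr germ_partial is f) / fact d) *\<^sub>R prod_list (map germ_coord is))"

definition taylor_nonzero :: "'n::finite germ \<Rightarrow> bool" where
  "taylor_nonzero f \<longleftrightarrow> (\<exists>d. taylor_component d f \<noteq> 0)"

text \<open>Only meaningful for germs with nonzero Taylor series.\<close>

definition initial_part :: "'n::finite germ \<Rightarrow> 'n germ" where
  "initial_part f = taylor_component (LEAST d. taylor_component d f \<noteq> 0) f"

text \<open>\<open>\<phi>\<close> is a representative of the germ; its values outside \<open>U\<close> are irrelevant.\<close>

definition C1_diffeo_germ :: "(real^'n::finite \<Rightarrow> real^'n) \<Rightarrow> bool" where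
  "C1_diffeo_germ \<phi> \<longleftrightarrow> \<phi> 0 = 0 \<and>
     (\<exists>U V \<psi>. open U \<and> open V \<and> 0 \<in> U \<and> homeomorphism U V \<phi> \<psi> \<and>
        C_k_on 1 \<phi> U \<and> C_k_on 1 \<psi> V)"

lemma C1_diffeo_germ_tendsto:
  assumes "C1_diffeo_germ \<phi>" shows "filterlim \<phi> (nhds 0) (nhds 0)"
proof -
  obtain U where "open U" "0 \<in> U" "continuous_on U \<phi>"
    using assms by (auto simp: C1_diffeo_germ_def homeomorphism_def)
  then have "isCont \<phi> 0" by (simp add: continuous_on_eq_continuous_at)
  then have "(\<phi> \<longlongrightarrow> \<phi> 0) (nhds 0)"
    by (simp add: continuous_at tendsto_at_iff_tendsto_nhds)
  then show ?thesis using assms by (simp add: C1_diffeo_germ_def)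
qed

lift_definition R_C1_equivalent :: "'n::finite germ \<Rightarrow> 'n germ \<Rightarrow> bool"
  is "\<lambda>f g. \<exists>\<phi>. C1_diffeo_germ \<phi> \<and> (\<forall>\<^sub>F x in nhds 0. f x = g (\<phi> x))"
proof -
  fix f f' g g' :: "real^'n \<Rightarrow> real"
  assume *: "germ_rel f f'" "germ_rel g g'"
  have "(\<forall>\<^sub>F x in nhds 0. f x = g (\<phi> x)) \<longleftrightarrow> (\<forall>\<^sub>F x in nhds 0. f' x = g' (\<phi> x))"
    if "C1_diffeo_germ \<phi>" for \<phi>
  proof (rule eventually_subst)
    have "\<forall>\<^sub>F x in nhds 0. g (\<phi> x) = g' (\<phi> x)"
      using C1_diffeo_germ_tendsto[OF that] *(2) by (auto simp: germ_rel_def filterlim_iff)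
    moreover have "\<forall>\<^sub>F x in nhds 0. f x = f' x" using *(1) by (simp add: germ_rel_def)
    ultimately show "\<forall>\<^sub>F x in nhds 0. (f x = g (\<phi> x)) = (f' x = g' (\<phi> x))"
      by eventually_elim simp
  qed
  then show "(\<exists>\<phi>. C1_diffeo_germ \<phi> \<and> (\<forall>\<^sub>F x in nhds 0. f x = g (\<phi> x))) =
     (\<exists>\<phi>. C1_diffeo_germ \<phi> \<and> (\<forall>\<^sub>F x in nhds 0. f' x = g' (\<phi> x)))" by blast
qed

end

theory Submission
  imports Defs
begin

text \<open>Dividing \<open>f(tx) = g(\<phi>(tx))\<close> by \<open>t\<^sup>d\<close> and letting \<open>t \<rightarrow> 0\<close> shows that the initial parts of
  \<open>f\<close> and \<open>g\<close> have the same degree \<open>d\<close> and differ by the linear isomorphism \<open>D\<phi>(0)\<close>; so it suffices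
  that \<open>\<mu>(f) = \<mu>(in(f))\<close> when the latter is finite. Let \<open>p\<^sub>i\<close> and \<open>q\<^sub>i\<close> be the partial derivatives of
  \<open>in(f)\<close> and \<open>f\<close>. A set \<open>B\<close> of monomials that is a basis modulo \<open>(p)\<close> is also one modulo \<open>(q)\<close>:
  it spans by successive approximation together with Nakayama's lemma. For independence, the leading
  parts of the coefficients of a relation \<open>\<Sum> c\<^sub>b b = \<Sum> a\<^sub>i q\<^sub>i\<close> form a syzygy of \<open>p\<close>. Since \<open>(p)\<close> contains
  powers of the coordinates, which form a regular sequence by Hadamard's lemma, the Koszul complex of
  \<open>p\<close> is exact, so this is a Koszul syzygy, and it lifts to one of \<open>q\<close>. Hence the order of the
  \<open>a\<^sub>i\<close> can be raised until it exceeds the degrees in \<open>B\<close>.\<close>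

section \<open>Stability properties of \<open>C\<^sup>k\<close> functions\<close>

text \<open>Composition with \<phi>, which is only once differentiable, does not preserve smooth
  germs, so \<open>J(f)\<close> and \<open>J(g)\<close> cannot be compared through it. A second
  obstacle is the ring: it is not Noetherian, and flat germs lie in every power of the maximal
  ideal, so Taylor series alone do not decide membership in an ideal. All approximations therefore
  stop at an order \<open>K\<close> from which on everything lies in both ideals. Monomials are
  chosen for \<open>B\<close> because a Taylor component then merely selects terms of a combination
  over \<open>B\<close>. The regular sequence used is that of the coordinates, since the quotients
  by coordinates are again rings of function germs, which makes nonzerodivisors easy to
  recognise.\<close>

lemma C_k_on_Suc_has_derivative:
  "C_k_on (Suc k) f U \<Longrightarrow> x \<in> U \<Longrightarrow> (f has_derivative frechet_derivative f (at x)) (at x)"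
  by (auto simp: frechet_derivative_works)

lemma C_k_on_SucI:
  assumes U: "open U" and d: "\<And>x. x \<in> U \<Longrightarrow> (f has_derivative f' x) (at x)"
    and c: "\<And>v. C_k_on k (\<lambda>x. f' x v) U"
  shows "C_k_on (Suc k) f U"
proof -
  have "frechet_derivative f (at x) = f' x" if "x \<in> U" for x
    using frechet_derivative_at[OF d[OF that]] by simp
  then have "C_k_on k (\<lambda>x. frechet_derivative f (at x) v) U" for v
    using C_k_on_cong[OF U, of "\<lambda>x. frechet_derivative f (at x) v" "\<lambda>x. f' x v"] c by auto
  with d show ?thesis by (auto simp: differentiable_def)
qed

lemma C_k_on_imp_continuous_on: "C_k_on k f U \<Longrightarrow> continuous_on U f"
  by (induction k) (auto intro: C_k_on_SucD simp del: C_k_on.simps(2))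

text \<open>The derivative of the composition in direction \<open>v\<close> is the derivative of
  \<open>f\<close> in the fixed direction \<open>A v\<close>, again composed with \<open>A\<close>;
  so induction over all \<open>f\<close> avoids a chain rule for higher derivatives.\<close>

lemma C_k_on_linear_comp:
  assumes A: "bounded_linear A" and V: "open V"
  shows "C_k_on k f V \<Longrightarrow> C_k_on k (\<lambda>x. f (A x)) (A -` V)"
proof (induction k arbitrary: f)
  case 0
  then show ?case
    using A linear_continuous_on[OF A, of "A -` V"] continuous_on_compose2[of V f "A -` V" A] by auto
next
  case (Suc k)
  have op: "open (A -` V)"
    using A V by (intro open_vimage) (simp_all add: linear_continuous_on)
  show ?case
  proof (rule C_k_on_SucI[OF op])
    fix x assume x: "x \<in> A -` V"
    show "((\<lambda>x. f (A x)) has_derivative (\<lambda>v. frechet_derivative f (at (A x)) (A v))) (at x)"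
      by (rule has_derivative_compose[OF bounded_linear_imp_has_derivative[OF A]
            C_k_on_Suc_has_derivative[OF Suc.prems]]) (use x in simp)
  next
    fix v
    show "C_k_on k (\<lambda>x. frechet_derivative f (at (A x)) (A v)) (A -` V)"
      using Suc.IH[of "\<lambda>y. frechet_derivative f (at y) (A v)"] Suc.prems by simp
  qed
qed

lemma C_k_on_inverse:
  fixes f :: "'a::euclidean_space \<Rightarrow> real"
  assumes U: "open U" and nz: "\<And>x. x \<in> U \<Longrightarrow> f x \<noteq> 0"
  shows "C_k_on k f U \<Longrightarrow> C_k_on k (\<lambda>x. inverse (f x)) U"
proof (induction k)
  case 0
  then show ?case using nz by (auto intro!: continuous_on_inverse)
next
  case (Suc k)
  have inv: "C_k_on k (\<lambda>x. inverse (f x)) U"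
    using Suc C_k_on_SucD by blast
  show ?case
  proof (rule C_k_on_SucI[OF U])
    fix x assume x: "x \<in> U"
    show "((\<lambda>x. inverse (f x)) has_derivative
        (\<lambda>v. (- 1) * (inverse (f x) * frechet_derivative f (at x) v * inverse (f x)))) (at x)"
      using Deriv.has_derivative_inverse[OF nz[OF x] C_k_on_Suc_has_derivative[OF Suc.prems x]] by simp
  next
    fix v
    show "C_k_on k (\<lambda>x. (- 1) * (inverse (f x) * frechet_derivative f (at x) v * inverse (f x))) U"
      using Suc.prems inv by (intro C_k_on_mult[OF U] C_k_on_const) auto
  qed
qed

section \<open>Division by a coordinate through integration along it\<close>

definition scale_coord :: "'n::finite \<Rightarrow> real \<Rightarrow> real^'n \<Rightarrow> real^'n" where
  "scale_coord j t x = x + ((t - 1) * x $ j) *\<^sub>R axis j 1"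

lemma scale_coord_nth: "scale_coord j t x $ i = (if i = j then t * x $ j else x $ i)"
  by (simp add: scale_coord_def axis_def algebra_simps)

lemma norm_scale_coord_le: "t \<in> {0..1} \<Longrightarrow> norm (scale_coord j t x) \<le> norm x"
  by (rule norm_le_componentwise_cart)
     (auto simp: scale_coord_nth abs_mult intro!: mult_left_le_one_le)

lemma bounded_linear_scale_coord: "bounded_linear (scale_coord j t)"
  unfolding scale_coord_def
  by (intro linear_conv_bounded_linear[THEN iffD1] linearI) (auto simp: algebra_simps)

lemma continuous_on_scale_coord [continuous_intros]:
  assumes "continuous_on S a" "continuous_on S b"
  shows "continuous_on S (\<lambda>s. scale_coord j (a s) (b s))"
  unfolding scale_coord_def by (intro continuous_intros assms)

lemma continuous_on_integrand:
  fixes f :: "real^'n \<Rightarrow> 'b::real_normed_vector"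
  assumes "continuous_on (ball 0 r) f"
  shows "continuous_on (ball 0 r \<times> {0..1}) (\<lambda>(x, t). t ^ m *\<^sub>R f (scale_coord j t x))"
  unfolding split_def
  by (intro continuous_intros continuous_on_compose2[OF assms])
     (auto intro: order_le_less_trans[OF norm_scale_coord_le[unfolded atLeastAtMost_iff]])

text \<open>The weight \<open>t ^ m\<close> closes the induction. Since
  \<open>scale_coord j t v\<close> is the \<open>t\<close>-free vector
  \<open>scale_coord j 0 v\<close> plus \<open>t * v $ j\<close> times a unit vector,
  differentiating under the integral gives integrals of the same shape, with weights
  \<open>t ^ m\<close> and \<open>t ^ Suc m\<close>.\<close>

lemma C_k_on_integral:
  fixes f :: "real^'n \<Rightarrow> real"
  shows "C_k_on k f (ball 0 r) \<Longrightarrow>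
    C_k_on k (\<lambda>x. integral {0..1} (\<lambda>t. t ^ m *\<^sub>R f (scale_coord j t x))) (ball 0 r)"
proof (induction k arbitrary: f m)
  case 0
  then show ?case
    using integral_continuous_on_param[of "ball 0 r" 0 1 "\<lambda>x t. t ^ m *\<^sub>R f (scale_coord j t x)"]
      continuous_on_integrand[of r f m j] by (simp add: cbox_interval)
next
  case (Suc k)
  let ?B = "ball (0 :: real^'n) r"
  define I where "I f m x = integral {0..1} (\<lambda>t. t ^ m *\<^sub>R f (scale_coord j t x))"
    for f :: "real^'n \<Rightarrow> real" and m x
  define D where "D v x = frechet_derivative f (at x) v" for v x
  have in_ball: "scale_coord j t x \<in> ?B" if "x \<in> ?B" "t \<in> {0..1}" for x t
    using norm_scale_coord_le[OF that(2), of j x] that(1) by auto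
  have hd: "(f has_derivative (\<lambda>v. D v x)) (at x)" if "x \<in> ?B" for x
    using C_k_on_Suc_has_derivative[OF Suc.prems that] by (simp add: D_def[abs_def])
  have bl: "bounded_linear (\<lambda>v. D v x)" if "x \<in> ?B" for x
    using hd[OF that] by (rule has_derivative_bounded_linear)
  have D: "C_k_on k (D v) ?B" for v using Suc.prems by (simp add: D_def[abs_def])
  have contD: "continuous_on ?B (D v)" for v
    using C_k_on_imp_continuous_on[OF D] .
  have contf: "continuous_on ?B f"
    using hd by (meson continuous_at_imp_continuous_on has_derivative_continuous)
  have intble: "(\<lambda>t. t ^ m' *\<^sub>R h (scale_coord j t x)) integrable_on {0..1}"
    if "continuous_on ?B h" "x \<in> ?B" for h :: "real^'n \<Rightarrow> real" and m' x
  proof (rule integrable_continuous_real)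
    show "continuous_on {0..1} (\<lambda>t. t ^ m' *\<^sub>R h (scale_coord j t x))"
      using in_ball[OF that(2)] by (intro continuous_intros continuous_on_compose2[OF that(1)]) auto
  qed
  \<comment> \<open>The Leibniz rule wants the derivative as a continuous family of bounded linear
    maps; \<open>Blinfun\<close> is known to give the intended one only for \<open>x\<close> in the
    ball and \<open>t\<close> in the unit interval.\<close>
  define F where "F x t = Blinfun (\<lambda>v. t ^ m *\<^sub>R D (scale_coord j t v) (scale_coord j t x))" for x t
  have F: "blinfun_apply (F x t) v = t ^ m *\<^sub>R D (scale_coord j t v) (scale_coord j t x)"
    if "x \<in> ?B" "t \<in> {0..1}" for x t v
    unfolding F_def
    by (subst bounded_linear_Blinfun_apply)
       (use bounded_linear_compose[OF bounded_linear_scaleR_right[of "t ^ m"]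
          bounded_linear_compose[OF bl[OF in_ball[OF that]] bounded_linear_scale_coord]] in simp_all)
  have F_eq: "blinfun_apply (F x t) v = t ^ m *\<^sub>R D (scale_coord j 0 v) (scale_coord j t x)
      + v $ j * (t ^ Suc m *\<^sub>R D (axis j 1) (scale_coord j t x))"
    if "x \<in> ?B" "t \<in> {0..1}" for x t v
  proof -
    have "scale_coord j t v = scale_coord j 0 v + (t * v $ j) *\<^sub>R axis j 1"
      by (simp add: scale_coord_def algebra_simps)
    then have "D (scale_coord j t v) (scale_coord j t x) =
        D (scale_coord j 0 v) (scale_coord j t x) + (t * v $ j) *\<^sub>R D (axis j 1) (scale_coord j t x)"
      using linear_add[OF bounded_linear.linear[OF bl[OF in_ball[OF that]]]]
        linear_scale[OF bounded_linear.linear[OF bl[OF in_ball[OF that]]]] by simp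
    then show ?thesis by (simp add: F[OF that] algebra_simps)
  qed
  have contF: "continuous_on (?B \<times> cbox 0 1) (\<lambda>(x, t). F x t)"
  proof (rule continuous_on_blinfun_componentwise)
    fix v :: "real^'n"
    have "continuous_on (?B \<times> {0..1}) (\<lambda>s. (\<lambda>(x, t). t ^ m *\<^sub>R D (scale_coord j 0 v) (scale_coord j t x)) s
      + v $ j * (\<lambda>(x, t). t ^ Suc m *\<^sub>R D (axis j 1) (scale_coord j t x)) s)"
      by (intro continuous_on_add continuous_on_mult continuous_on_const continuous_on_integrand contD)
    then show "continuous_on (?B \<times> cbox 0 1) (\<lambda>s. blinfun_apply (case s of (x, t) \<Rightarrow> F x t) v)"
      by (subst continuous_on_cong[OF refl]) (auto simp: F_eq cbox_interval)
  qed
  show ?case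
  proof (rule C_k_on_SucI[OF open_ball])
    fix x assume x: "x \<in> ?B"
    have "((\<lambda>x. integral (cbox 0 1) (\<lambda>t. t ^ m *\<^sub>R f (scale_coord j t x))) has_derivative
       blinfun_apply (integral (cbox 0 1) (F x))) (at x within ?B)"
    proof (rule leibniz_rule[OF _ _ contF x convex_ball])
      fix x :: "real^'n" and t :: real assume xt: "x \<in> ?B" "t \<in> cbox 0 1"
      then have xt': "x \<in> ?B" "t \<in> {0..1}" by (auto simp: cbox_interval)
      have "((\<lambda>x. t ^ m *\<^sub>R f (scale_coord j t x)) has_derivative blinfun_apply (F x t)) (at x)"
        unfolding F[OF xt', abs_def]
        by (intro has_derivative_scaleR_right has_derivative_compose[OF
              bounded_linear_imp_has_derivative[OF bounded_linear_scale_coord] hd] in_ball xt')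
      then show "((\<lambda>x. t ^ m *\<^sub>R f (scale_coord j t x)) has_derivative blinfun_apply (F x t)) (at x within ?B)"
        by (rule has_derivative_at_withinI)
    qed (use intble[OF contf] in \<open>auto simp: cbox_interval\<close>)
    then have 1: "((\<lambda>x. integral {0..1} (\<lambda>t. t ^ m *\<^sub>R f (scale_coord j t x))) has_derivative
       blinfun_apply (integral (cbox 0 1) (F x))) (at x)"
      using x by (simp add: at_within_open[OF _ open_ball] cbox_interval)
    have "continuous_on (cbox 0 1) (\<lambda>t. (\<lambda>(x, t). F x t) (x, t))"
      by (rule continuous_on_compose2[OF contF]) (use x in \<open>auto intro!: continuous_intros\<close>)
    then have int: "F x integrable_on cbox 0 1"
      by (intro integrable_continuous) simp
    have eq: "blinfun_apply (integral (cbox 0 1) (F x)) v =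
        I (D (scale_coord j 0 v)) m x + v $ j * I (D (axis j 1)) (Suc m) x" for v
    proof -
      have "blinfun_apply (integral (cbox 0 1) (F x)) v = integral (cbox 0 1) (\<lambda>t. blinfun_apply (F x t) v)"
        using integral_linear[OF int blinfun.bounded_linear_left[of v]] by (simp add: o_def)
      also have "\<dots> = integral {0..1} (\<lambda>t. t ^ m *\<^sub>R D (scale_coord j 0 v) (scale_coord j t x)
      + v $ j * (t ^ Suc m *\<^sub>R D (axis j 1) (scale_coord j t x)))"
        by (auto simp: cbox_interval F_eq[OF x] intro!: integral_cong)
      also have "\<dots> = I (D (scale_coord j 0 v)) m x + v $ j * I (D (axis j 1)) (Suc m) x"
        unfolding I_def
        by (subst integral_add[OF intble[OF contD x] integrable_on_mult_right[OF intble[OF contD x]]]) simp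
      finally show ?thesis .
    qed
    have "blinfun_apply (integral (cbox 0 1) (F x)) =
        (\<lambda>v. I (D (scale_coord j 0 v)) m x + v $ j * I (D (axis j 1)) (Suc m) x)"
      by (rule ext) (rule eq)
    with 1 show "((\<lambda>x. integral {0..1} (\<lambda>t. t ^ m *\<^sub>R f (scale_coord j t x))) has_derivative
       (\<lambda>v. I (D (scale_coord j 0 v)) m x + v $ j * I (D (axis j 1)) (Suc m) x)) (at x)"
      by simp
  next
    fix v
    show "C_k_on k (\<lambda>x. I (D (scale_coord j 0 v)) m x + v $ j * I (D (axis j 1)) (Suc m) x) ?B"
      unfolding I_def
      by (intro C_k_on_add[OF open_ball] C_k_on_mult[OF open_ball] C_k_on_const Suc.IH D)
  qed
qed

text \<open>Fundamental theorem of calculus along the segment from \<open>scale_coord j 0 x\<close>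
  to \<open>x\<close>. The factor \<open>t ^ 0\<close> puts the integral in the form of
  \<open>C_k_on_integral\<close>.\<close>

lemma hadamard_coord:
  fixes f :: "real^'n \<Rightarrow> real"
  assumes f: "C_k_on 1 f (ball 0 r)" and x: "x \<in> ball 0 r"
  shows "f x = f (scale_coord j 0 x) +
    x $ j * integral {0..1} (\<lambda>t. t ^ 0 *\<^sub>R frechet_derivative f (at (scale_coord j t x)) (axis j 1))"
proof -
  have in_ball: "scale_coord j t x \<in> ball 0 r" if "t \<in> {0..1}" for t
    using norm_scale_coord_le[OF that, of j x] x by auto
  have "((\<lambda>t. f (scale_coord j t x)) has_vector_derivative
      x $ j * frechet_derivative f (at (scale_coord j t x)) (axis j 1)) (at t within {0..1})"
    if t: "t \<in> {0..1}" for t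
  proof -
    have hd: "(f has_derivative frechet_derivative f (at (scale_coord j t x))) (at (scale_coord j t x))"
      using C_k_on_Suc_has_derivative[of 0 f] f in_ball[OF t] by simp
    have "((\<lambda>t. scale_coord j t x) has_vector_derivative (x $ j *\<^sub>R axis j 1)) (at t within {0..1})"
      unfolding scale_coord_def by (auto intro!: derivative_eq_intros)
    from vector_derivative_diff_chain_within[OF this has_derivative_at_withinI[OF hd]]
    show ?thesis
      using linear_scale[OF has_derivative_linear[OF hd]] by (simp add: o_def)
  qed
  from fundamental_theorem_of_calculus[OF _ this]
  have "((\<lambda>t. x $ j * frechet_derivative f (at (scale_coord j t x)) (axis j 1)) has_integral
     f (scale_coord j 1 x) - f (scale_coord j 0 x)) {0..1}" by simp
  then have "f (scale_coord j 1 x) - f (scale_coord j 0 x) =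
    x $ j * integral {0..1} (\<lambda>t. frechet_derivative f (at (scale_coord j t x)) (axis j 1))"
    by (metis integral_unique integral_mult_right)
  then show ?thesis by (simp add: scale_coord_def)
qed

section \<open>Operations on germs\<close>

lemma frechet_derivative_at': "(f has_derivative f') (at x) \<Longrightarrow> frechet_derivative f (at x) = f'"
  by (rule frechet_derivative_at[symmetric])

lemma smooth_near_0_ballE:
  assumes "smooth_near_0 f"
  obtains r where "r > 0" "\<And>k. C_k_on k f (ball 0 r)"
proof -
  obtain U where U: "open U" "0 \<in> U" "\<And>k. C_k_on k f U"
    using assms by (auto simp: smooth_near_0_def)
  then obtain r where r: "r > 0" "ball 0 r \<subseteq> U" using open_contains_ball by blast
  show thesis by (rule that[OF r(1) C_k_on_subset[OF U(3) r(2)]])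
qed

lemma smooth_near_0I_ball: "r > 0 \<Longrightarrow> (\<And>k. C_k_on k f (ball 0 r)) \<Longrightarrow> smooth_near_0 f"
  unfolding smooth_near_0_def by (intro exI[of _ "ball 0 r"]) auto

lemma smooth_near_0_partial:
  assumes "smooth_near_0 f"
  shows "smooth_near_0 (\<lambda>x. frechet_derivative f (at x) v)"
proof -
  obtain r where r: "r > 0" "\<And>k. C_k_on (Suc k) f (ball 0 r)"
    using assms by (meson smooth_near_0_ballE)
  then have "C_k_on k (\<lambda>x. frechet_derivative f (at x) v) (ball 0 r)" for k using r(2)[of k] by simp
  with r(1) show ?thesis by (rule smooth_near_0I_ball)
qed

lemma smooth_near_0_eventually_has_derivative:
  assumes "smooth_near_0 f"
  shows "\<forall>\<^sub>F x in nhds 0. (f has_derivative frechet_derivative f (at x)) (at x)"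
proof -
  obtain r where "r > 0" "C_k_on (Suc 0) f (ball 0 r)" using assms by (meson smooth_near_0_ballE)
  then show ?thesis
    by (intro eventually_mono[OF eventually_nhds_in_open[of "ball 0 r"]])
       (simp, simp, rule C_k_on_Suc_has_derivative)
qed

lemma smooth_near_0_eventually_isCont:
  assumes "smooth_near_0 f"
  shows "\<forall>\<^sub>F x in nhds 0. isCont f x"
  using smooth_near_0_eventually_has_derivative[OF assms]
  by eventually_elim (rule has_derivative_continuous)



lemma abs_germ_induct [case_names 1]:
  assumes "\<And>g. smooth_near_0 g \<Longrightarrow> P (abs_germ g)" shows "P f"
  using assms by (metis Quotient_abs_rep Quotient_germ Quotient_rep_reflp germ_rel_def)

lemma abs_germ_eq_iff:
  "smooth_near_0 f \<Longrightarrow> smooth_near_0 g \<Longrightarrow> abs_germ f = abs_germ g \<longleftrightarrow> (\<forall>\<^sub>F x in nhds 0. f x = g x)"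
  using Quotient_rel[OF Quotient_germ, of f g] by (simp add: germ_rel_def)

lemma smooth_near_0_linear_comp:
  fixes A :: "real^'n^'n"
  assumes "smooth_near_0 f" shows "smooth_near_0 (\<lambda>x. f (A *v x))"
proof -
  obtain U where U: "open U" "0 \<in> U" "\<And>k. C_k_on k f U"
    using assms by (auto simp: smooth_near_0_def)
  have A: "bounded_linear ((*v) A)" by (rule matrix_vector_mul_bounded_linear)
  show ?thesis unfolding smooth_near_0_def
    using C_k_on_linear_comp[OF A U(1,3)] U(1,2) A
    by (intro exI[of _ "(*v) A -` U"]) (auto intro: open_vimage simp: linear_continuous_on)
qed

lemma eventually_nhds_0_linear:
  fixes A :: "real^'n^'n"
  assumes "\<forall>\<^sub>F x in nhds 0. P x" shows "\<forall>\<^sub>F x in nhds 0. P (A *v x)"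
proof -
  have "((\<lambda>x. A *v x) \<longlongrightarrow> A *v 0) (nhds 0)"
    unfolding tendsto_at_iff_tendsto_nhds[symmetric]
    using linear_continuous_at[OF matrix_vector_mul_bounded_linear[of A], of 0]
    by (simp only: continuous_at)
  then show ?thesis using assms by (auto simp: filterlim_iff)
qed

section \<open>Linear substitutions, partial derivatives and values of germs\<close>

lift_definition germ_linsubst :: "real^'n^'n \<Rightarrow> 'n::finite germ \<Rightarrow> 'n germ"
  is "\<lambda>A f x. f (A *v x)"
  unfolding germ_rel_def
  using eventually_nhds_0_linear[where P = "\<lambda>x. _ x = _ x"] smooth_near_0_linear_comp by blast

lemma germ_linsubst_add: "germ_linsubst A (f + g) = germ_linsubst A f + germ_linsubst A g"
  by transfer (simp add: germ_rel_def smooth_near_0_linear_comp smooth_near_0_add)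

lemma germ_linsubst_mult: "germ_linsubst A (f * g) = germ_linsubst A f * germ_linsubst A g"
  by transfer (simp add: germ_rel_def smooth_near_0_linear_comp smooth_near_0_mult)

lemma germ_linsubst_scaleR: "germ_linsubst A (c *\<^sub>R f) = c *\<^sub>R germ_linsubst A f"
  by transfer (simp add: germ_rel_def smooth_near_0_linear_comp smooth_near_0_mult smooth_near_0_const)

lemma germ_linsubst_0 [simp]: "germ_linsubst A 0 = 0"
  using germ_linsubst_scaleR[of A 0 0] by simp

lemma germ_linsubst_sum: "germ_linsubst A (sum f S) = (\<Sum>x\<in>S. germ_linsubst A (f x))"
  by (induction S rule: infinite_finite_induct) (auto simp: germ_linsubst_add)

lemma germ_linsubst_linsubst: "germ_linsubst A (germ_linsubst B f) = germ_linsubst (B ** A) f"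
  by transfer (simp add: germ_rel_def smooth_near_0_linear_comp matrix_vector_mul_assoc)

lemma germ_linsubst_id: "germ_linsubst (mat 1) f = f"
  by transfer simp

lemma germ_partial_add: "germ_partial i (f + g) = germ_partial i f + germ_partial i g"
proof transfer
  fix i and f g :: "real^'a \<Rightarrow> real"
  assume "germ_rel f f" "germ_rel g g"
  then have s: "smooth_near_0 f" "smooth_near_0 g" by (auto simp: germ_rel_def)
  have "\<forall>\<^sub>F x in nhds 0. frechet_derivative (\<lambda>x. f x + g x) (at x) (axis i 1) =
     frechet_derivative f (at x) (axis i 1) + frechet_derivative g (at x) (axis i 1)"
    using s[THEN smooth_near_0_eventually_has_derivative]
    by eventually_elim (simp add: frechet_derivative_at'[OF has_derivative_add])
  with s show "germ_rel (\<lambda>x. frechet_derivative (\<lambda>x. f x + g x) (at x) (axis i 1))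
     (\<lambda>x. frechet_derivative f (at x) (axis i 1) + frechet_derivative g (at x) (axis i 1))"
    by (simp add: germ_rel_def smooth_near_0_add smooth_near_0_partial)
qed

lemma germ_partial_mult: "germ_partial i (f * g) = f * germ_partial i g + germ_partial i f * g"
proof transfer
  fix i and f g :: "real^'a \<Rightarrow> real"
  assume "germ_rel f f" "germ_rel g g"
  then have s: "smooth_near_0 f" "smooth_near_0 g" by (auto simp: germ_rel_def)
  have "\<forall>\<^sub>F x in nhds 0. frechet_derivative (\<lambda>x. f x * g x) (at x) (axis i 1) =
     f x * frechet_derivative g (at x) (axis i 1) + frechet_derivative f (at x) (axis i 1) * g x"
    using s[THEN smooth_near_0_eventually_has_derivative]
    by eventually_elim (simp add: frechet_derivative_at'[OF has_derivative_mult])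
  with s show "germ_rel (\<lambda>x. frechet_derivative (\<lambda>x. f x * g x) (at x) (axis i 1))
     (\<lambda>x. f x * frechet_derivative g (at x) (axis i 1) + frechet_derivative f (at x) (axis i 1) * g x)"
    by (simp add: germ_rel_def smooth_near_0_add smooth_near_0_mult smooth_near_0_partial)
qed

lemma germ_partial_1 [simp]: "germ_partial i 1 = 0"
  using germ_partial_mult[of i 1 1] by simp

lemma germ_partial_scaleR: "germ_partial i (c *\<^sub>R f) = c *\<^sub>R germ_partial i f"
proof transfer
  fix i c and f :: "real^'a \<Rightarrow> real"
  assume "germ_rel f f"
  then have s: "smooth_near_0 f" by (auto simp: germ_rel_def)
  have "\<forall>\<^sub>F x in nhds 0. frechet_derivative (\<lambda>x. c * f x) (at x) (axis i 1) =
     c * frechet_derivative f (at x) (axis i 1)"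
    using s[THEN smooth_near_0_eventually_has_derivative]
    by eventually_elim (simp add: frechet_derivative_at'[OF has_derivative_mult_right])
  with s show "germ_rel (\<lambda>x. frechet_derivative (\<lambda>x. c * f x) (at x) (axis i 1))
     (\<lambda>x. c * frechet_derivative f (at x) (axis i 1))"
    by (simp add: germ_rel_def smooth_near_0_mult smooth_near_0_const smooth_near_0_partial)
qed

lemma germ_partial_0 [simp]: "germ_partial i 0 = 0"
  using germ_partial_scaleR[of i 0 0] by simp

lemma germ_partial_minus: "germ_partial i (f - g) = germ_partial i f - germ_partial i g"
  using germ_partial_add[of i "f - g" g] by simp

lemma germ_partial_coord: "germ_partial i (germ_coord j) = (if i = j then 1 else 0)"
proof -
  have "frechet_derivative (\<lambda>x. x $ j) (at x) = (\<lambda>x. x $ j)" for x :: "real^'a"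
    by (rule frechet_derivative_at'[OF bounded_linear_imp_has_derivative[OF bounded_linear_vec_nth]])
  then have "frechet_derivative (\<lambda>x. x $ j) (at x) (axis i 1) = (if i = j then 1 else (0::real))"
    for x :: "real^'a" by (simp add: axis_def)
  then show ?thesis
    by (cases "i = j"; simp; transfer) (simp_all add: germ_rel_def smooth_near_0_const)
qed

text \<open>Smoothness and the identity are proved together because computing with
  \<open>abs_germ\<close> in the induction step requires smooth representatives.\<close>

lemma abs_germ_sum:
  assumes "\<And>j. j \<in> S \<Longrightarrow> smooth_near_0 (h j)"
  shows "smooth_near_0 (\<lambda>x. \<Sum>j\<in>S. c j * h j x) \<and>
    (\<Sum>j\<in>S. c j *\<^sub>R abs_germ (h j)) = abs_germ (\<lambda>x. \<Sum>j\<in>S. c j * h j x)"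
  using assms
  by (induction S rule: infinite_finite_induct)
     (simp_all add: zero_germ_def germ_rel_def plus_germ.abs_eq scaleR_germ.abs_eq
       smooth_near_0_const smooth_near_0_add smooth_near_0_mult)

lemma germ_partial_linsubst:
  "germ_partial i (germ_linsubst A f) = (\<Sum>j\<in>UNIV. A $ j $ i *\<^sub>R germ_linsubst A (germ_partial j f))"
proof (induction f rule: abs_germ_induct)
  case (1 g)
  have eq: "frechet_derivative (\<lambda>x. g (A *v x)) (at x) (axis i 1) =
     (\<Sum>j\<in>UNIV. A $ j $ i * frechet_derivative g (at (A *v x)) (axis j 1))"
    if "(g has_derivative frechet_derivative g (at (A *v x))) (at (A *v x))" for x
  proof -
    note lin = has_derivative_linear[OF that]
    have "A *v axis i 1 = (\<Sum>j\<in>UNIV. A $ j $ i *\<^sub>R axis j 1)"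
      unfolding matrix_vector_mult_basis
      by (simp add: vec_eq_iff column_def axis_def if_distrib sum.delta cong: if_cong)
    then have "frechet_derivative g (at (A *v x)) (A *v axis i 1) =
      (\<Sum>j\<in>UNIV. A $ j $ i * frechet_derivative g (at (A *v x)) (axis j 1))"
      by (simp add: linear_sum[OF lin] linear_scale[OF lin])
    with frechet_derivative_at'[OF has_derivative_compose[OF bounded_linear_imp_has_derivative[OF
          matrix_vector_mul_bounded_linear[of A]] that]]
    show ?thesis by simp
  qed
  define h where "h j x = frechet_derivative g (at (A *v x)) (axis j 1)" for j x
  have h: "smooth_near_0 (h j)" for j
    unfolding h_def by (rule smooth_near_0_linear_comp smooth_near_0_partial 1)+
  note S = abs_germ_sum[of UNIV h "\<lambda>j. A $ j $ i", OF h]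
  have "\<forall>\<^sub>F x in nhds 0. frechet_derivative (\<lambda>x. g (A *v x)) (at x) (axis i 1) =
     (\<Sum>j\<in>UNIV. A $ j $ i * h j x)"
    unfolding h_def
    using eventually_nhds_0_linear[OF smooth_near_0_eventually_has_derivative[OF 1], of A]
    by eventually_elim (rule eq)
  then have "abs_germ (\<lambda>x. frechet_derivative (\<lambda>x. g (A *v x)) (at x) (axis i 1)) =
      abs_germ (\<lambda>x. \<Sum>j\<in>UNIV. A $ j $ i * h j x)"
    using S by (subst abs_germ_eq_iff) (auto intro: smooth_near_0_partial smooth_near_0_linear_comp 1)
  moreover have "germ_linsubst A (germ_partial j (abs_germ g)) = abs_germ (h j)" for j
    by (simp add: germ_linsubst.abs_eq germ_partial.abs_eq germ_rel_def smooth_near_0_partial 1 h_def[abs_def])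
  ultimately show ?case
    using S by (simp add: germ_linsubst.abs_eq germ_partial.abs_eq germ_rel_def smooth_near_0_linear_comp 1)
qed

lemma germ_value_add: "germ_value (f + g) = germ_value f + germ_value g"
  by transfer simp

lemma germ_value_mult: "germ_value (f * g) = germ_value f * germ_value g"
  by transfer simp

lemma germ_value_minus: "germ_value (f - g) = germ_value f - germ_value g"
  by transfer simp

lemma germ_value_scaleR: "germ_value (c *\<^sub>R f) = c * germ_value f"
  by transfer simp

lemma germ_value_0 [simp]: "germ_value 0 = 0"
  by transfer simp

lemma germ_value_1 [simp]: "germ_value 1 = 1"
  by transfer simp

lemma germ_value_coord [simp]: "germ_value (germ_coord i) = 0"
  by transfer simp

lemma germ_inverse:
  "germ_value f \<noteq> 0 \<Longrightarrow> \<exists>g. f * g = 1"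
proof (induction f rule: abs_germ_induct)
  case (1 f)
  then have s: "smooth_near_0 f" and f: "f 0 \<noteq> 0"
    by (simp_all add: germ_value.abs_eq germ_rel_def)
  obtain r where r: "r > 0" "\<And>k. C_k_on k f (ball 0 r)" using s by (meson smooth_near_0_ballE)
  have "continuous_on (ball 0 r) f" using r(2)[of 0] by simp
  then have op: "open (ball 0 r \<inter> f -` (- {0}))"
    by (intro continuous_open_preimage) auto
  have "C_k_on k (\<lambda>x. inverse (f x)) (ball 0 r \<inter> f -` (- {0}))" for k
    by (intro C_k_on_inverse[OF op] C_k_on_subset[OF r(2)]) auto
  then have s': "smooth_near_0 (\<lambda>x. inverse (f x))"
    using op r f unfolding smooth_near_0_def by (intro exI[of _ "ball 0 r \<inter> f -` (- {0})"]) auto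
  moreover have "\<forall>\<^sub>F x in nhds 0. f x * inverse (f x) = 1"
    using op r f by (intro eventually_mono[OF eventually_nhds_in_open[OF op]]) auto
  ultimately show ?case
    using s by (intro exI[of _ "abs_germ (\<lambda>x. inverse (f x))"])
      (simp add: times_germ.abs_eq one_germ_def abs_germ_eq_iff germ_rel_def smooth_near_0_mult smooth_near_0_const)
qed

text \<open>The ring has zero divisors, but a coordinate is none: near \<open>0\<close> the other
  factor vanishes off the hyperplane \<open>x $ j = 0\<close>, which has empty interior, and hence
  on it by continuity.\<close>

lemma germ_coord_mult_eq_0:
  assumes "germ_coord j * f = 0" shows "f = 0"
  using assms
proof transfer
  fix j and f :: "real^'a \<Rightarrow> real"
  assume f: "germ_rel f f" and "germ_rel (\<lambda>x. x $ j * f x) (\<lambda>x. 0)"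
  then have s: "smooth_near_0 f" and "\<forall>\<^sub>F x in nhds 0. x $ j * f x = 0" by (simp_all add: germ_rel_def)
  then have "\<forall>\<^sub>F x in nhds 0. isCont f x \<and> (\<forall>\<^sub>F y in nhds x. y $ j * f y = 0)"
    by (intro eventually_conj smooth_near_0_eventually_isCont) (simp_all add: eventually_eventually)
  then have "\<forall>\<^sub>F x in nhds 0. f x = 0"
  proof eventually_elim
    case (elim x)
    show "f x = 0"
    proof (cases "x $ j = 0")
      case False
      then show ?thesis using eventually_nhds_x_imp_x[OF conjunct2[OF elim]] by simp
    next
      case True
      define y where "y t = x + t *\<^sub>R axis j 1" for t :: real
      have y: "(y \<longlongrightarrow> x) (at 0)" unfolding y_def by (auto intro!: tendsto_eq_intros)
      have "((\<lambda>t. f (y t)) \<longlongrightarrow> f x) (at 0)"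
        using isCont_tendsto_compose[OF _ y] elim by blast
      moreover have "\<forall>\<^sub>F t in at 0. f (y t) = 0"
      proof -
        have "\<forall>\<^sub>F t in at 0. y t $ j * f (y t) = 0"
          using y elim by (auto simp: filterlim_iff)
        moreover have "\<forall>\<^sub>F t in at 0. t \<noteq> (0::real)" by (simp add: eventually_at_filter)
        ultimately show ?thesis by eventually_elim (simp add: y_def True)
      qed
      then have "((\<lambda>t. f (y t)) \<longlongrightarrow> 0) (at 0)" by (rule tendsto_eventually)
      ultimately show "f x = 0" by (intro tendsto_unique[of "at (0::real)"]) auto
    qed
  qed
  then show "germ_rel f (\<lambda>x. 0)" using s by (simp add: germ_rel_def smooth_near_0_const)
qed

text \<open>A projection given as a matrix, so that restriction to a coordinate subspace is a case
  of \<open>germ_linsubst\<close> and thus a ring homomorphism. Its kernel turns out to be the ideal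
  of the coordinates in \<open>S\<close>.\<close>

definition kill_coords :: "'n::finite set \<Rightarrow> real^'n^'n" where
  "kill_coords S = (\<chi> a b. if a = b \<and> a \<notin> S then 1 else 0)"

lemma kill_coords_mult: "(kill_coords S *v x) $ a = (if a \<in> S then 0 else x $ a)"
proof -
  have "(\<Sum>b\<in>UNIV. (if a = b \<and> a \<notin> S then 1 else 0) * x $ b) = (if a \<in> S then 0 else x $ a)"
    by (cases "a \<in> S") (simp_all add: if_distrib[of "\<lambda>c. c * _"] sum.delta cong: if_cong)
  then show ?thesis
    by (simp add: kill_coords_def matrix_vector_mult_def)
qed

lemma kill_coords_singleton_mult: "kill_coords {j} *v x = scale_coord j 0 x"
  by (simp add: vec_eq_iff kill_coords_mult scale_coord_nth)

lemma kill_coords_insert: "kill_coords S ** kill_coords {j} = kill_coords (insert j S)"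
proof -
  have "(kill_coords S ** kill_coords {j}) *v x = kill_coords (insert j S) *v x" for x :: "real^'a"
    by (auto simp: vec_eq_iff kill_coords_mult simp flip: matrix_vector_mul_assoc)
  then show ?thesis using matrix_eq by blast
qed

lemma germ_linsubst_kill_coords_UNIV: "germ_linsubst (kill_coords UNIV) f = germ_value f *\<^sub>R 1"
proof (induction f rule: abs_germ_induct)
  case (1 g)
  have "kill_coords UNIV *v x = 0" for x :: "real^'a" by (simp add: vec_eq_iff kill_coords_mult)
  with 1 show ?case
    by (simp add: germ_linsubst.abs_eq germ_value.abs_eq one_germ_def scaleR_germ.abs_eq germ_rel_def
        smooth_near_0_const)
qed

lemma germ_linsubst_kill_coords:
  "germ_linsubst (kill_coords S) (germ_coord i) = (if i \<in> S then 0 else germ_coord i)"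
  by (cases "i \<in> S"; simp; transfer)
     (simp_all add: kill_coords_mult germ_rel_def smooth_near_0_nth smooth_near_0_const)

lemma germ_hadamard: "\<exists>g. f = germ_linsubst (kill_coords {j}) f + germ_coord j * g"
proof (induction f rule: abs_germ_induct)
  case (1 f)
  note s = this
  then obtain r where r: "r > 0" "\<And>k. C_k_on k f (ball 0 r)" by (meson smooth_near_0_ballE)
  define g where "g x = integral {0..1} (\<lambda>t. t ^ 0 *\<^sub>R frechet_derivative f (at (scale_coord j t x)) (axis j 1))" for x
  have "C_k_on k (\<lambda>x. frechet_derivative f (at x) (axis j 1)) (ball 0 r)" for k
    using r(2)[of "Suc k"] by simp
  then have "C_k_on k g (ball 0 r)" for k
    unfolding g_def by (rule C_k_on_integral)
  with r(1) have g: "smooth_near_0 g" by (rule smooth_near_0I_ball)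
  have "\<forall>\<^sub>F x in nhds 0. f x = f (kill_coords {j} *v x) + x $ j * g x"
    using hadamard_coord[OF r(2)] r(1)
    by (intro eventually_mono[OF eventually_nhds_in_open[of "ball 0 r"]])
       (simp_all add: g_def kill_coords_singleton_mult)
  with s g show ?case
    by (intro exI[of _ "abs_germ g"]) (simp add: germ_linsubst.abs_eq germ_coord_def times_germ.abs_eq
       plus_germ.abs_eq abs_germ_eq_iff germ_rel_def smooth_near_0_add smooth_near_0_mult
       smooth_near_0_nth smooth_near_0_linear_comp)
qed

section \<open>Ideals and the Koszul complex\<close>

lemma ring_module: "module ((*) :: 'a::comm_ring_1 \<Rightarrow> 'a \<Rightarrow> 'a)"
  by unfold_locales (auto simp: algebra_simps)

lemma ideal_generated_base: "x \<in> S \<Longrightarrow> x \<in> ideal_generated S"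
  by (simp add: ideal_generated_def module.span_base[OF ring_module])

lemma ideal_generated_0 [simp]: "0 \<in> ideal_generated S"
  by (simp add: ideal_generated_def module.span_zero[OF ring_module])

lemma ideal_generated_add: "x \<in> ideal_generated S \<Longrightarrow> y \<in> ideal_generated S \<Longrightarrow> x + y \<in> ideal_generated S"
  by (simp add: ideal_generated_def module.span_add[OF ring_module])

lemma ideal_generated_diff: "x \<in> ideal_generated S \<Longrightarrow> y \<in> ideal_generated S \<Longrightarrow> x - y \<in> ideal_generated S"
  by (simp add: ideal_generated_def module.span_diff[OF ring_module])

lemma ideal_generated_uminus: "x \<in> ideal_generated S \<Longrightarrow> - x \<in> ideal_generated S"
  by (simp add: ideal_generated_def module.span_neg[OF ring_module])

lemma ideal_generated_mult: "x \<in> ideal_generated S \<Longrightarrow> a * x \<in> ideal_generated S"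
  by (simp add: ideal_generated_def module.span_scale[OF ring_module])

lemma ideal_generated_mult': "x \<in> ideal_generated S \<Longrightarrow> x * a \<in> ideal_generated S"
  using ideal_generated_mult by (metis mult.commute)

lemma ideal_generated_sum: "(\<And>i. i \<in> I \<Longrightarrow> f i \<in> ideal_generated S) \<Longrightarrow> sum f I \<in> ideal_generated S"
  by (simp add: ideal_generated_def module.span_sum[OF ring_module])

lemma ideal_generated_mono: "S \<subseteq> T \<Longrightarrow> ideal_generated S \<subseteq> ideal_generated T"
  by (simp add: ideal_generated_def module.span_mono[OF ring_module])

lemma ideal_generated_empty: "ideal_generated {} = {0}"
  by (simp add: ideal_generated_def module.span_empty[OF ring_module])

lemma ideal_generated_induct [consumes 1, case_names zero add mult]:
  assumes "x \<in> ideal_generated S" "P 0" "\<And>x y. P x \<Longrightarrow> P y \<Longrightarrow> P (x + y)" "\<And>a x. x \<in> S \<Longrightarrow> P (a * x)"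
  shows "P x"
proof (rule module.span_induct_alt[OF ring_module, of x S P])
  show "x \<in> module.span (*) S" using assms(1) by (simp add: ideal_generated_def)
qed (auto intro: assms)

lemma ideal_generated_least:
  assumes "S \<subseteq> ideal_generated T" shows "ideal_generated S \<subseteq> ideal_generated T"
  using assms module.span_minimal[OF ring_module] module.subspace_span[OF ring_module]
  unfolding ideal_generated_def by blast

lemma in_ideal_generated_insert:
  "y \<in> ideal_generated (insert x S) \<longleftrightarrow> (\<exists>a. y - a * x \<in> ideal_generated S)"
  by (simp add: ideal_generated_def module.span_insert[OF ring_module])

lemma in_ideal_generated_range:
  fixes p :: "'i::finite \<Rightarrow> 'a::comm_ring_1"
  shows "y \<in> ideal_generated (range p) \<longleftrightarrow> (\<exists>a. y = (\<Sum>i\<in>UNIV. a i * p i))"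
proof
  assume "y \<in> ideal_generated (range p)"
  then show "\<exists>a. y = (\<Sum>i\<in>UNIV. a i * p i)"
  proof (induction rule: ideal_generated_induct)
    case zero
    show ?case by (intro exI[of _ "\<lambda>_. 0"]) simp
  next
    case (add x y)
    then obtain a b where "x = (\<Sum>i\<in>UNIV. a i * p i)" "y = (\<Sum>i\<in>UNIV. b i * p i)" by blast
    then show ?case by (intro exI[of _ "\<lambda>i. a i + b i"]) (simp add: distrib_right sum.distrib)
  next
    case (mult c x)
    then obtain j where "x = p j" by blast
    then show ?case
      by (intro exI[of _ "\<lambda>i. if i = j then c else 0"]) (simp add: if_distrib[of "\<lambda>c. c * _"] cong: if_cong)
  qed
qed (auto intro: ideal_generated_sum ideal_generated_mult ideal_generated_base)

text \<open>Koszul complex of a sequence \<open>p\<^sub>1, \<dots>, p\<^sub>n\<close>: a subset of \<open>{1..n}\<close> is encoded by its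
  characteristic list of length \<open>n\<close>, so that degree \<open>j\<close> consists of the functions on the lists
  with \<open>j\<close> entries \<open>True\<close>. Functions are total; values on other lists play no role. The
  recursion builds the complex as an iterated mapping cone.\<close>

fun koszul_d :: "'a::comm_ring_1 list \<Rightarrow> (bool list \<Rightarrow> 'a) \<Rightarrow> bool list \<Rightarrow> 'a" where
  "koszul_d (p # ps) z (b # w) =
     (if b then - koszul_d ps (\<lambda>v. z (True # v)) w
      else koszul_d ps (\<lambda>v. z (False # v)) w + p * z (True # w))"
| "koszul_d _ z _ = 0"

text \<open>Exterior multiplication by the element with coordinates \<open>cs\<close>, dual to the
  contraction \<open>koszul_d\<close>; the minus sign comes from moving it past the first basis
  vector.\<close>

fun koszul_h :: "'a::comm_ring_1 list \<Rightarrow> (bool list \<Rightarrow> 'a) \<Rightarrow> bool list \<Rightarrow> 'a" where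
  "koszul_h (c # cs) z (b # w) =
     (if b then c * z (False # w) - koszul_h cs (\<lambda>v. z (True # v)) w
      else koszul_h cs (\<lambda>v. z (False # v)) w)"
| "koszul_h _ z _ = 0"

lemma koszul_d_add: "koszul_d ps (\<lambda>v. z v + z' v) w = koszul_d ps z w + koszul_d ps z' w"
proof (induction ps arbitrary: z z' w)
  case (Cons p ps)
  then show ?case by (cases w) (simp_all add: algebra_simps)
qed simp

lemma koszul_d_mult: "koszul_d ps (\<lambda>v. a * z v) w = a * koszul_d ps z w"
  by (induction ps z w rule: koszul_d.induct) (auto simp: algebra_simps)

lemma koszul_d_uminus: "koszul_d ps (\<lambda>v. - z v) w = - koszul_d ps z w"
  using koszul_d_mult[of ps "- 1"] by simp

lemma koszul_d_diff: "koszul_d ps (\<lambda>v. z v - z' v) w = koszul_d ps z w - koszul_d ps z' w"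
  using koszul_d_add[of ps z "\<lambda>v. - z' v"] by (simp add: koszul_d_uminus)

lemma koszul_d_0: "koszul_d ps (\<lambda>v. 0) w = 0"
  using koszul_d_mult[of ps 0] by simp

lemma koszul_h_add: "koszul_h ps (\<lambda>v. z v + z' v) w = koszul_h ps z w + koszul_h ps z' w"
proof (induction ps arbitrary: z z' w)
  case (Cons p ps)
  then show ?case by (cases w) (simp_all add: algebra_simps)
qed simp

lemma koszul_h_mult: "koszul_h ps (\<lambda>v. a * z v) w = a * koszul_h ps z w"
  by (induction ps z w rule: koszul_h.induct) (auto simp: algebra_simps)

lemma koszul_h_uminus: "koszul_h ps (\<lambda>v. - z v) w = - koszul_h ps z w"
  using koszul_h_mult[of ps "- 1"] by simp

lemma koszul_d_d: "koszul_d ps (koszul_d ps z) w = 0"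
  by (induction ps z w rule: koszul_d.induct)
     (auto simp: koszul_d_add koszul_d_mult koszul_d_uminus)

text \<open>Contraction and exterior multiplication anticommute up to the pairing of
  \<open>cs\<close> with \<open>ps\<close>. Hence every element of the ideal generated by
  \<open>ps\<close> acts as zero on the homology.\<close>

lemma koszul_homotopy:
  assumes "length cs = length ps" "length w = length ps"
  shows "koszul_d ps (koszul_h cs z) w + koszul_h cs (koszul_d ps z) w =
    (\<Sum>(c, p)\<leftarrow>zip cs ps. c * p) * z w"
  using assms
proof (induction cs ps arbitrary: w z rule: list_induct2)
  case (Cons c cs p ps)
  then obtain b v where w: "w = b # v" "length v = length ps" by (cases w) auto
  note IH = Cons.IH[OF w(2)]
  show ?case
    by (cases b) (simp_all add: w koszul_d_add koszul_d_diff koszul_d_mult koszul_h_add koszul_h_mult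
          koszul_h_uminus distrib_right IH[of "\<lambda>v. z (True # v)", symmetric]
          IH[of "\<lambda>v. z (False # v)", symmetric], simp_all add: algebra_simps)
qed simp

abbreviation bool_words :: "nat \<Rightarrow> nat \<Rightarrow> bool list set" where
  "bool_words n j \<equiv> {w. length w = n \<and> count_list w True = j}"

text \<open>The differential at \<open>w\<close> reads \<open>z\<close> only at words with one more
  \<open>True\<close>, so knowledge of \<open>z\<close> in a single degree suffices. For empty
  \<open>S\<close>, applied to a difference, this becomes \<open>koszul_d_cong\<close>.\<close>

lemma koszul_d_in_ideal:
  assumes "\<And>v. length v = length w \<Longrightarrow> count_list v True = Suc (count_list w True) \<Longrightarrow> z v \<in> ideal_generated S"
  shows "koszul_d ps z w \<in> ideal_generated S"
  using assms
  by (induction ps z w rule: koszul_d.induct)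
     (auto intro!: ideal_generated_add ideal_generated_mult ideal_generated_uminus)

lemma koszul_h_in_ideal:
  assumes "\<And>v. length v = length w \<Longrightarrow> Suc (count_list v True) = count_list w True \<Longrightarrow> z v \<in> ideal_generated S"
  shows "koszul_h ps z w \<in> ideal_generated S"
  using assms
  by (induction ps z w rule: koszul_h.induct)
     (auto intro!: ideal_generated_add ideal_generated_mult ideal_generated_diff)

lemma koszul_d_cong:
  assumes "\<And>v. length v = length w \<Longrightarrow> count_list v True = Suc (count_list w True) \<Longrightarrow> z v = z' v"
  shows "koszul_d ps z w = koszul_d ps z' w"
  using koszul_d_in_ideal[of w "\<lambda>v. z v - z' v" "{}" ps] assms
  by (simp add: koszul_d_diff ideal_generated_empty)

lemma koszul_d_in_ideal_generated: "koszul_d ps z w \<in> ideal_generated (set ps)"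
proof (induction ps z w rule: koszul_d.induct)
  case (1 p ps z b w)
  have "ideal_generated (set ps) \<subseteq> ideal_generated (set (p # ps))"
    by (rule ideal_generated_mono) auto
  with 1 show ?case
    using ideal_generated_mult'[OF ideal_generated_base[of p "set (p # ps)"]]
    by (cases b) (auto intro: ideal_generated_add ideal_generated_uminus)
qed auto

text \<open>The coefficient of the \<open>i\<close>-th generator sits at the word whose only
  \<open>True\<close> is at position \<open>i\<close>; the all-\<open>False\<close> word is the
  single word of degree zero.\<close>

lemma ideal_generated_imp_koszul_d:
  "v \<in> ideal_generated (set ps) \<Longrightarrow> \<exists>z. v = koszul_d ps z (replicate (length ps) False)"
proof (induction ps arbitrary: v)
  case (Cons p ps)
  then obtain a where "v - a * p \<in> ideal_generated (set ps)"
    by (auto simp: in_ideal_generated_insert)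
  from Cons.IH[OF this] obtain z where "v - a * p = koszul_d ps z (replicate (length ps) False)" ..
  then show ?case
    by (intro exI[of _ "\<lambda>w. if hd w then a else z (tl w)"]) (simp add: algebra_simps)
qed (simp add: ideal_generated_empty)

text \<open>Vanishing of the homology in degree \<open>j\<close> with coefficients modulo the ideal generated by \<open>S\<close>.\<close>

definition koszul_exact :: "'a::comm_ring_1 list \<Rightarrow> 'a set \<Rightarrow> nat \<Rightarrow> bool" where
  "koszul_exact ps S j \<longleftrightarrow>
    (\<forall>z. (\<forall>w. length w = length ps \<longrightarrow> Suc (count_list w True) = j \<longrightarrow> koszul_d ps z w \<in> ideal_generated S) \<longrightarrow>
      (\<exists>u. \<forall>w\<in>bool_words (length ps) j. z w - koszul_d ps u w \<in> ideal_generated S))"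

lemma in_ideal_generated_imp_sum_list:
  "v \<in> ideal_generated (set ps) \<Longrightarrow> \<exists>cs. length cs = length ps \<and> v = (\<Sum>(c, p)\<leftarrow>zip cs ps. c * p)"
proof (induction ps arbitrary: v)
  case (Cons p ps)
  then obtain a where "v - a * p \<in> ideal_generated (set ps)"
    by (auto simp: in_ideal_generated_insert)
  from Cons.IH[OF this] obtain cs where "length cs = length ps" "v - a * p = (\<Sum>(c, p)\<leftarrow>zip cs ps. c * p)"
    by blast
  then show ?case by (intro exI[of _ "a # cs"]) (simp add: algebra_simps)
qed (simp add: ideal_generated_empty)

text \<open>If \<open>x\<close> is a nonzerodivisor modulo \<open>S\<close>, then by the long exact sequence exactness modulo \<open>(S, x)\<close>
  in degree \<open>j + 1\<close> makes \<open>x\<close> injective on the homology in degree \<open>j\<close>, which is however killed by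
  a power of \<open>x\<close>.\<close>

lemma koszul_exact_step:
  assumes nzd: "\<And>a. x * a \<in> ideal_generated S \<Longrightarrow> a \<in> ideal_generated S"
    and pow: "x ^ N \<in> ideal_generated (set ps)"
    and ex: "koszul_exact ps (insert x S) (Suc j)"
  shows "koszul_exact ps S j"
  unfolding koszul_exact_def
proof (intro allI impI)
  let ?n = "length ps"
  \<comment> \<open>If \<open>x * z\<close> is the boundary of \<open>y\<close> modulo
    \<open>S\<close>, then \<open>y\<close> is a cycle modulo \<open>S\<close> and \<open>x\<close>,
    hence \<open>y = d u + x * t\<close> modulo \<open>S\<close>. Applying \<open>d\<close> gives
    \<open>x * (z - d t) = 0\<close> modulo \<open>S\<close>, and \<open>x\<close> cancels.\<close>
  have inj: "\<exists>u. \<forall>w\<in>bool_words ?n j. z w - koszul_d ps u w \<in> ideal_generated S"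
    if y: "\<forall>w\<in>bool_words ?n j. x * z w - koszul_d ps y w \<in> ideal_generated S" for y z
  proof -
    have "koszul_d ps y w \<in> ideal_generated (insert x S)" if "w \<in> bool_words ?n j" for w
      unfolding in_ideal_generated_insert
      using ideal_generated_uminus[OF y[rule_format, OF that]] by (auto intro!: exI[of _ "z w"] simp: mult.commute)
    then obtain u where "\<forall>w\<in>bool_words ?n (Suc j). y w - koszul_d ps u w \<in> ideal_generated (insert x S)"
      using ex unfolding koszul_exact_def by force
    then have "\<forall>w\<in>bool_words ?n (Suc j). \<exists>a. y w - koszul_d ps u w - a * x \<in> ideal_generated S"
      by (simp add: in_ideal_generated_insert)
    then obtain t where t: "\<And>w. w \<in> bool_words ?n (Suc j) \<Longrightarrow> y w - koszul_d ps u w - t w * x \<in> ideal_generated S"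
      by metis
    have "z w - koszul_d ps t w \<in> ideal_generated S" if w: "w \<in> bool_words ?n j" for w
    proof (rule nzd)
      have "koszul_d ps (\<lambda>w. y w - koszul_d ps u w - x * t w) w \<in> ideal_generated S"
        using w t by (intro koszul_d_in_ideal) (auto simp: mult.commute)
      then have "koszul_d ps y w - x * koszul_d ps t w \<in> ideal_generated S"
        by (simp add: koszul_d_diff koszul_d_mult koszul_d_d)
      from ideal_generated_add[OF this y[rule_format, OF w]]
      show "x * (z w - koszul_d ps t w) \<in> ideal_generated S" by (simp add: algebra_simps)
    qed
    then show ?thesis by blast
  qed
  fix z
  assume z: "\<forall>w. length w = ?n \<longrightarrow> Suc (count_list w True) = j \<longrightarrow> koszul_d ps z w \<in> ideal_generated S"
  obtain cs where cs: "length cs = ?n" "x ^ N = (\<Sum>(c, p)\<leftarrow>zip cs ps. c * p)"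
    using in_ideal_generated_imp_sum_list[OF pow] by blast
  \<comment> \<open>The homotopy makes \<open>x ^ N * z\<close> a boundary; each use of
    \<open>inj\<close> removes one factor \<open>x\<close>.\<close>
  have "\<exists>u. \<forall>w\<in>bool_words ?n j. x ^ (N - m) * z w - koszul_d ps u w \<in> ideal_generated S" if "m \<le> N" for m
    using that
  proof (induction m)
    case 0
    have "x ^ N * z w - koszul_d ps (koszul_h cs z) w \<in> ideal_generated S" if "w \<in> bool_words ?n j" for w
    proof -
      have "koszul_h cs (koszul_d ps z) w \<in> ideal_generated S"
        using that z by (intro koszul_h_in_ideal) auto
      moreover have "koszul_d ps (koszul_h cs z) w + koszul_h cs (koszul_d ps z) w = x ^ N * z w"
        unfolding cs(2) by (rule koszul_homotopy) (use cs(1) that in auto)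
      ultimately show ?thesis by (simp flip: \<open>_ = x ^ N * z w\<close>)
    qed
    then show ?case by auto
  next
    case (Suc m)
    then have "N - m = Suc (N - Suc m)" by auto
    then show ?case
      using inj[of "\<lambda>w. x ^ (N - Suc m) * z w"] Suc by (auto simp: mult.assoc)
  qed
  from this[of N] show "\<exists>u. \<forall>w\<in>bool_words ?n j. z w - koszul_d ps u w \<in> ideal_generated S" by simp
qed

text \<open>Depth sensitivity by descending induction on \<open>S\<close>: adding an element to
  \<open>S\<close> and raising \<open>j\<close> by one keeps \<open>card S < j\<close>. Once
  \<open>S\<close> is everything, \<open>j\<close> exceeds the length of the words and degree
  \<open>j\<close> is empty. Empty \<open>S\<close> gives exactness in all positive degrees over the
  ring itself.\<close>

lemma koszul_exact_regular:
  fixes x :: "'i::finite \<Rightarrow> 'a::comm_ring_1"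
  assumes reg: "\<And>S i a. i \<notin> S \<Longrightarrow> x i * a \<in> ideal_generated (x ` S) \<Longrightarrow> a \<in> ideal_generated (x ` S)"
    and pow: "\<And>i. \<exists>N. x i ^ N \<in> ideal_generated (set ps)"
    and len: "length ps = CARD('i)"
    and j: "card S < j"
  shows "koszul_exact ps (x ` S) j"
  using j
proof (induction "card (UNIV - S)" arbitrary: S j rule: less_induct)
  case less
  show ?case
  proof (cases "S = UNIV")
    case True
    then have "bool_words (length ps) j = {}"
    proof (intro equals0I)
      fix w assume "w \<in> bool_words (length ps) j"
      then show False using count_le_length[of w True] less.prems len True by simp
    qed
    then show ?thesis by (simp only: koszul_exact_def) simp
  next
    case False
    then obtain i where i: "i \<notin> S" by auto
    obtain N where N: "x i ^ N \<in> ideal_generated (set ps)" using pow by blast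
    have "koszul_exact ps (x ` insert i S) (Suc j)"
      using i less.prems by (intro less.hyps psubset_card_mono) auto
    then show ?thesis
      using koszul_exact_step[OF reg[OF i] N] by simp
  qed
qed

section \<open>The grading by Taylor components\<close>

text \<open>Coordinates are killed one at a time; each difference is a multiple of one coordinate by
  Hadamard's lemma, and the differences telescope.\<close>

lemma diff_kill_coords_in_ideal:
  "finite S \<Longrightarrow> f - germ_linsubst (kill_coords S) f \<in> ideal_generated (germ_coord ` S)"
proof (induction S rule: finite_induct)
  case empty
  have "kill_coords {} = (mat 1 :: real^'a^'a)" by (simp add: kill_coords_def mat_def)
  then show ?case by (simp add: germ_linsubst_id)
next
  case (insert j S)
  define g where "g = germ_linsubst (kill_coords S) f"
  obtain h where h: "g = germ_linsubst (kill_coords {j}) g + germ_coord j * h"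
    using germ_hadamard by blast
  have "f - g \<in> ideal_generated (germ_coord ` insert j S)"
    using insert.IH ideal_generated_mono[of "germ_coord ` S" "germ_coord ` insert j S"]
    by (auto simp: g_def)
  moreover have "g - germ_linsubst (kill_coords {j}) g \<in> ideal_generated (germ_coord ` insert j S)"
  proof -
    have "g - germ_linsubst (kill_coords {j}) g = germ_coord j * h"
      using h by (metis add_diff_cancel_left')
    then show ?thesis by (simp add: ideal_generated_mult' ideal_generated_base)
  qed
  ultimately have "(f - g) + (g - germ_linsubst (kill_coords {j}) g) \<in> ideal_generated (germ_coord ` insert j S)"
    by (rule ideal_generated_add)
  then show ?case by (simp add: g_def germ_linsubst_linsubst kill_coords_insert)
qed

text \<open>The ideal is the kernel of \<open>germ_linsubst (kill_coords S)\<close>, so one may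
  compute with restricted germs. The coordinate \<open>i\<close> survives the restriction and is not
  a zero divisor.\<close>

lemma germ_coord_regular:
  assumes i: "i \<notin> S" and a: "germ_coord i * a \<in> ideal_generated (germ_coord ` S)"
  shows "a \<in> ideal_generated (germ_coord ` S)"
proof -
  have "germ_linsubst (kill_coords S) f = 0" if "f \<in> ideal_generated (germ_coord ` S)" for f
    using that
    by (induction rule: ideal_generated_induct)
       (auto simp: germ_linsubst_add germ_linsubst_mult germ_linsubst_kill_coords)
  from this[OF a] have "germ_coord i * germ_linsubst (kill_coords S) a = 0"
    using i by (simp add: germ_linsubst_mult germ_linsubst_kill_coords)
  then have "germ_linsubst (kill_coords S) a = 0" by (rule germ_coord_mult_eq_0)
  then show ?thesis using diff_kill_coords_in_ideal[of S a] by simp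
qed

abbreviation germ_monom :: "'n::finite list \<Rightarrow> 'n germ" where
  "germ_monom w \<equiv> prod_list (map germ_coord w)"

definition hom_germs :: "nat \<Rightarrow> 'n::finite germ set" where
  "hom_germs k = span {germ_monom w | w. length w = k}"

text \<open>The \<open>k\<close>-th power of the maximal ideal. It is characterised below by
  vanishing Taylor components (\<open>order_ideal_iff\<close>) and by a growth bound
  (\<open>order_ideal_iff_germ_bigo\<close>).\<close>

definition order_ideal :: "nat \<Rightarrow> 'n::finite germ set" where
  "order_ideal k = ideal_generated {germ_monom w | w. length w = k}"

lemmas order_ideal_add = ideal_generated_add[where S = "{germ_monom w | w. length w = k}" for k,
  folded order_ideal_def]
lemmas order_ideal_diff = ideal_generated_diff[where S = "{germ_monom w | w. length w = k}" for k,
  folded order_ideal_def]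
lemmas order_ideal_mult = ideal_generated_mult[where S = "{germ_monom w | w. length w = k}" for k,
  folded order_ideal_def]
lemmas order_ideal_mult' = ideal_generated_mult'[where S = "{germ_monom w | w. length w = k}" for k,
  folded order_ideal_def]
lemmas order_ideal_sum = ideal_generated_sum[where S = "{germ_monom w | w. length w = k}" for k,
  folded order_ideal_def]

lemma zero_in_order_ideal [simp]: "0 \<in> order_ideal k"
  by (simp add: order_ideal_def)

lemma germ_scaleR_conv_mult: "c *\<^sub>R f = (c *\<^sub>R 1) * (f :: 'n::finite germ)"
  by simp

lemma ideal_generated_scaleR: "f \<in> ideal_generated S \<Longrightarrow> c *\<^sub>R (f :: 'n::finite germ) \<in> ideal_generated S"
  by (subst germ_scaleR_conv_mult) (rule ideal_generated_mult)

lemma subspace_ideal_generated: "subspace (ideal_generated S :: 'n::finite germ set)"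
  by (simp add: subspace_def ideal_generated_add ideal_generated_scaleR)

lemma subspace_order_ideal: "subspace (order_ideal k)"
  by (simp add: order_ideal_def subspace_ideal_generated)

lemma subspace_hom_germs: "subspace (hom_germs k)"
  by (simp add: hom_germs_def)

lemma germ_monom_in_hom_germs: "germ_monom w \<in> hom_germs (length w)"
  unfolding hom_germs_def by (rule span_base) auto

lemma germ_monom_in_order_ideal: "germ_monom w \<in> order_ideal (length w)"
  unfolding order_ideal_def by (rule ideal_generated_base) auto

lemma hom_germs_subset_order_ideal: "hom_germs k \<subseteq> order_ideal k"
  unfolding hom_germs_def
  by (rule span_minimal) (auto simp: subspace_order_ideal germ_monom_in_order_ideal)

lemma hom_germs_mult: "f \<in> hom_germs i \<Longrightarrow> g \<in> hom_germs j \<Longrightarrow> f * g \<in> hom_germs (i + j)"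
proof -
  assume f: "f \<in> hom_germs i" and g: "g \<in> hom_germs j"
  have *: "germ_monom v * g \<in> hom_germs (i + j)" if "length v = i" for v
    using g unfolding hom_germs_def[of j]
  proof (induction rule: span_induct_alt)
    case base
    show ?case by (simp add: subspace_0 subspace_hom_germs)
  next
    case (step c b y)
    then obtain w where "b = germ_monom w" "length w = j" by auto
    then have "germ_monom v * b \<in> hom_germs (i + j)"
      using germ_monom_in_hom_germs[of "v @ w"] that by simp
    with step show ?case
      by (simp add: distrib_left subspace_add subspace_hom_germs subspace_scale)
  qed
  show "f * g \<in> hom_germs (i + j)"
    using f unfolding hom_germs_def[of i]
  proof (induction rule: span_induct_alt)
    case base
    show ?case by (simp add: subspace_0 subspace_hom_germs)
  next
    case (step c b y)
    with * show ?case
      by (auto simp: distrib_right subspace_add subspace_hom_germs subspace_scale)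
  qed
qed

lemma order_ideal_mult_order_ideal:
  assumes f: "f \<in> order_ideal i" and g: "g \<in> order_ideal j"
  shows "f * g \<in> order_ideal (i + j)"
proof -
  have *: "germ_monom v * g \<in> order_ideal (i + j)" if "length v = i" for v
    using g unfolding order_ideal_def[of j]
  proof (induction rule: ideal_generated_induct)
    case (mult a x)
    then obtain w where w: "x = germ_monom w" "length w = j" by auto
    have "a * germ_monom (v @ w) \<in> order_ideal (i + j)"
      using germ_monom_in_order_ideal[of "v @ w"] w(2) that by (intro order_ideal_mult) simp
    then show ?case by (simp add: w ac_simps)
  qed (auto simp: distrib_left order_ideal_add)
  show ?thesis
    using f unfolding order_ideal_def[of i]
  proof (induction rule: ideal_generated_induct)
    case (mult a x)
    then have "x * g \<in> order_ideal (i + j)" using * by auto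
    then show ?case by (simp add: mult.assoc order_ideal_mult)
  qed (auto simp: distrib_right order_ideal_add)
qed

lemma order_ideal_antimono: "i \<le> j \<Longrightarrow> order_ideal j \<subseteq> order_ideal i"
  unfolding order_ideal_def
proof (rule ideal_generated_least, safe)
  fix w :: "'a list" assume "i \<le> length w"
  then have "germ_monom (take i w) * germ_monom (drop i w) \<in> ideal_generated {germ_monom w | w. length w = i}"
    by (intro ideal_generated_mult' ideal_generated_base) auto
  then show "germ_monom w \<in> ideal_generated {germ_monom w | w. length w = i}"
    by (simp only: prod_list.append[symmetric] map_append[symmetric] append_take_drop_id)
qed

lemma order_ideal_0_eq_UNIV: "order_ideal 0 = UNIV"
  using ideal_generated_mult[OF ideal_generated_base[of 1 "{1}"]] by (auto simp: order_ideal_def)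

text \<open>The truncated subtraction is harmless for the empty word, whose derivative is zero and
  so homogeneous of every degree.\<close>

lemma germ_partial_monom: "germ_partial i (germ_monom w) \<in> hom_germs (length w - 1)"
proof (induction w)
  case Nil
  show ?case by (simp add: subspace_0 subspace_hom_germs)
next
  case (Cons a w)
  have "germ_coord a * germ_partial i (germ_monom w) \<in> hom_germs (length w)"
  proof (cases w)
    case Nil
    then show ?thesis by (simp add: subspace_0 subspace_hom_germs)
  next
    case (Cons b v)
    show ?thesis
      using hom_germs_mult[OF germ_monom_in_hom_germs[of "[a]"] Cons.IH] Cons by simp
  qed
  then show ?case
    using germ_monom_in_hom_germs[of w]
    by (auto simp: germ_partial_mult germ_partial_coord subspace_hom_germs intro!: subspace_add)
qed

lemma germ_partial_hom_germs:
  assumes "f \<in> hom_germs k" shows "germ_partial i f \<in> hom_germs (k - 1)"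
  using assms unfolding hom_germs_def[of k]
proof (induction rule: span_induct_alt)
  case base
  show ?case by (simp add: subspace_0 subspace_hom_germs)
next
  case (step c b y)
  then show ?case
    using germ_partial_monom[of i]
    by (auto simp: germ_partial_add germ_partial_scaleR subspace_hom_germs intro!: subspace_add subspace_scale)
qed

lemma hom_germs_0_iff: "f \<in> hom_germs 0 \<longleftrightarrow> (\<exists>c. f = c *\<^sub>R 1)"
  by (auto simp: hom_germs_def span_singleton)

lemma germ_partial_order_ideal:
  assumes "f \<in> order_ideal (Suc k)" shows "germ_partial i f \<in> order_ideal k"
  using assms unfolding order_ideal_def[of "Suc k"]
proof (induction rule: ideal_generated_induct)
  case (mult a x)
  then obtain w where w: "x = germ_monom w" "length w = Suc k" by auto
  then have "germ_partial i x \<in> order_ideal k" "x \<in> order_ideal k"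
    using germ_partial_monom[of i w] hom_germs_subset_order_ideal germ_monom_in_order_ideal[of w]
      order_ideal_antimono[of k "Suc k"] by auto
  then show ?case by (simp add: germ_partial_mult order_ideal_add order_ideal_mult)
qed (auto simp: germ_partial_add order_ideal_add)

text \<open>In \<open>taylor_component_hom_germs\<close> the factor \<open>k\<close> cancels the one
  in the recursion \<open>taylor_component_Suc\<close>, so that a homogeneous germ is its own Taylor
  component.\<close>

lemma euler_identity:
  assumes "f \<in> hom_germs k"
  shows "(\<Sum>i\<in>UNIV. germ_coord i * germ_partial i f) = real k *\<^sub>R f"
proof -
  have monom: "(\<Sum>i\<in>UNIV. germ_coord i * germ_partial i (germ_monom w)) = real (length w) *\<^sub>R germ_monom w" for w :: "'a list"
  proof (induction w)
    case (Cons a w)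
    have "(\<Sum>i\<in>UNIV. germ_coord i * germ_partial i (germ_monom (a # w))) =
        germ_coord a * (\<Sum>i\<in>UNIV. germ_coord i * germ_partial i (germ_monom w)) +
        (\<Sum>i\<in>UNIV. if i = a then germ_monom (a # w) else 0)"
      unfolding sum_distrib_left sum.distrib[symmetric]
      by (intro sum.cong) (auto simp: germ_partial_mult germ_partial_coord algebra_simps)
    then show ?case by (simp add: Cons.IH algebra_simps)
  qed simp
  show ?thesis
    using assms unfolding hom_germs_def
  proof (induction rule: span_induct_alt)
    case (step c b y)
    have "(\<Sum>i\<in>UNIV. germ_coord i * germ_partial i (c *\<^sub>R b + y)) =
      c *\<^sub>R (\<Sum>i\<in>UNIV. germ_coord i * germ_partial i b) + (\<Sum>i\<in>UNIV. germ_coord i * germ_partial i y)"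
      by (simp add: germ_partial_add germ_partial_scaleR distrib_left sum.distrib scaleR_sum_right)
    also have "\<dots> = real k *\<^sub>R (c *\<^sub>R b + y)"
      using step monom by (auto simp: algebra_simps)
    finally show ?case .
  qed simp
qed

section \<open>Taylor components and Taylor's formula\<close>

lemma taylor_component_0: "taylor_component 0 f = germ_value f *\<^sub>R 1"
  by (simp add: taylor_component_def)

text \<open>Words are split at their last letter, the one that \<open>foldr\<close> applies first;
  in this form the recursion does not require partial derivatives to commute.\<close>

lemma taylor_component_Suc:
  "taylor_component (Suc k) f =
     (1 / real (Suc k)) *\<^sub>R (\<Sum>i\<in>UNIV. germ_coord i * taylor_component k (germ_partial i f))"
proof -
  have bij: "bij_betw (\<lambda>(i, w). w @ [i]) (UNIV \<times> {w. length w = k}) {w :: 'a list. length w = Suc k}"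
    by (rule bij_betwI[where g = "\<lambda>w. (last w, butlast w)"])
       (auto simp: length_Suc_conv_rev)
  have "taylor_component (Suc k) f = (\<Sum>(i, w)\<in>UNIV \<times> {w. length w = k}.
      (germ_value (foldr germ_partial w (germ_partial i f)) / fact (Suc k)) *\<^sub>R (germ_monom w * germ_coord i))"
    unfolding taylor_component_def
    by (subst sum.reindex_bij_betw[OF bij, symmetric]) (auto intro!: sum.cong)
  also have "\<dots> = (\<Sum>i\<in>UNIV. \<Sum>w | length w = k.
      (germ_value (foldr germ_partial w (germ_partial i f)) / fact (Suc k)) *\<^sub>R (germ_monom w * germ_coord i))"
    by (subst sum.cartesian_product) auto
  also have "\<dots> = (1 / real (Suc k)) *\<^sub>R (\<Sum>i\<in>UNIV. germ_coord i * taylor_component k (germ_partial i f))"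
    unfolding taylor_component_def sum_distrib_left scaleR_sum_right
    by (intro sum.cong refl) (simp add: mult.commute)
  finally show ?thesis .
qed

lemma taylor_component_add: "taylor_component k (f + g) = taylor_component k f + taylor_component k g"
  by (induction k arbitrary: f g)
     (simp_all add: taylor_component_0 taylor_component_Suc germ_value_add germ_partial_add
       scaleR_add_left distrib_left sum.distrib scaleR_add_right)

lemma taylor_component_scaleR: "taylor_component k (c *\<^sub>R f) = c *\<^sub>R taylor_component k f"
  by (induction k arbitrary: f)
     (simp_all add: taylor_component_0 taylor_component_Suc germ_value_scaleR germ_partial_scaleR
       scaleR_sum_right)

lemma taylor_component_zero [simp]: "taylor_component k 0 = 0"
  using taylor_component_scaleR[of k 0 0] by simp

lemma taylor_component_diff: "taylor_component k (f - g) = taylor_component k f - taylor_component k g"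
  using taylor_component_add[of k "f - g" g] by simp

lemma taylor_component_sum: "taylor_component k (sum f S) = (\<Sum>x\<in>S. taylor_component k (f x))"
  by (induction S rule: infinite_finite_induct) (auto simp: taylor_component_add)

lemma taylor_component_in_hom_germs: "taylor_component k f \<in> hom_germs k"
  unfolding taylor_component_def using germ_monom_in_hom_germs
  by (auto intro!: subspace_sum subspace_scale subspace_hom_germs)

lemma germ_value_order_ideal:
  assumes "f \<in> order_ideal (Suc k)" shows "germ_value f = 0"
  using assms unfolding order_ideal_def
  by (induction rule: ideal_generated_induct)
     (auto simp: germ_value_add germ_value_mult length_Suc_conv)

lemma taylor_component_order_ideal: "f \<in> order_ideal k \<Longrightarrow> j < k \<Longrightarrow> taylor_component j f = 0"
proof (induction j arbitrary: f k)
  case 0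
  then show ?case using germ_value_order_ideal[of f "k - 1"] by (simp add: taylor_component_0)
next
  case (Suc j)
  then obtain k' where k': "k = Suc k'" "j < k'" by (cases k) auto
  have "taylor_component j (germ_partial i f) = 0" for i
    using Suc.IH[OF germ_partial_order_ideal k'(2)] Suc.prems k' by blast
  then show ?case by (simp add: taylor_component_Suc)
qed

lemma taylor_component_hom_germs:
  "f \<in> hom_germs k \<Longrightarrow> taylor_component j f = (if j = k then f else 0)"
proof (induction j arbitrary: f k)
  case 0
  show ?case
  proof (cases k)
    case 0
    then show ?thesis
      using \<open>f \<in> hom_germs k\<close> by (auto simp: hom_germs_0_iff taylor_component_0 germ_value_scaleR)
  next
    case (Suc k')
    then show ?thesis
      using \<open>f \<in> hom_germs k\<close> hom_germs_subset_order_ideal[of k] taylor_component_order_ideal[of f k 0] by auto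
  qed
next
  case (Suc j)
  show ?case
  proof (cases k)
    case 0
    then show ?thesis using Suc.prems by (auto simp: hom_germs_0_iff taylor_component_Suc germ_partial_scaleR)
  next
    case (Suc k')
    have "taylor_component j (germ_partial i f) = (if j = k' then germ_partial i f else 0)" for i
      using Suc.IH[OF germ_partial_hom_germs[OF Suc.prems, of i]] Suc by simp
    then have "taylor_component (Suc j) f = (1 / real (Suc j)) *\<^sub>R
        (if j = k' then \<Sum>i\<in>UNIV. germ_coord i * germ_partial i f else 0)"
      by (simp add: taylor_component_Suc)
    then show ?thesis
      using euler_identity[OF Suc.prems] Suc by simp
  qed
qed

text \<open>Iterating \<open>f = f(0) + sum of a_i * x_i\<close> produces some approximation by
  homogeneous pieces; applying \<open>taylor_component\<close> to it then identifies the pieces. No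
  analytic remainder estimate is involved.\<close>

lemma taylor_theorem: "f - (\<Sum>j<k. taylor_component j f) \<in> order_ideal k"
proof -
  have ex: "\<exists>h. (\<forall>j. h j \<in> hom_germs j) \<and> f - (\<Sum>j<k. h j) \<in> order_ideal k"
  proof (induction k arbitrary: f)
    case 0
    show ?case
      by (intro exI[of _ "\<lambda>j. 0"]) (simp add: order_ideal_0_eq_UNIV subspace_0 subspace_hom_germs)
  next
    case (Suc k)
    have "f - germ_value f *\<^sub>R 1 \<in> ideal_generated (range germ_coord)"
      using diff_kill_coords_in_ideal[of UNIV f] by (simp add: germ_linsubst_kill_coords_UNIV)
    then obtain a where a: "f - germ_value f *\<^sub>R 1 = (\<Sum>i\<in>UNIV. a i * germ_coord i)"
      by (auto simp: in_ideal_generated_range)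
    from Suc.IH have "\<forall>i. \<exists>h. (\<forall>j. h j \<in> hom_germs j) \<and> a i - (\<Sum>j<k. h j) \<in> order_ideal k" by blast
    then obtain h where h: "\<And>i j. h i j \<in> hom_germs j" "\<And>i. a i - (\<Sum>j<k. h i j) \<in> order_ideal k"
      by metis
    define h' where "h' j = (case j of 0 \<Rightarrow> germ_value f *\<^sub>R 1 | Suc j \<Rightarrow> \<Sum>i\<in>UNIV. h i j * germ_coord i)" for j
    have "f - (\<Sum>j<Suc k. h' j) = (f - germ_value f *\<^sub>R 1) - (\<Sum>j<k. \<Sum>i\<in>UNIV. h i j * germ_coord i)"
      unfolding sum.lessThan_Suc_shift by (simp add: h'_def)
    also have "\<dots> = (\<Sum>i\<in>UNIV. (a i - (\<Sum>j<k. h i j)) * germ_coord i)"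
      unfolding a by (subst sum.swap) (simp add: left_diff_distrib sum_subtractf sum_distrib_right)
    also have "\<dots> \<in> order_ideal (Suc k)"
      using order_ideal_mult_order_ideal[OF h(2) germ_monom_in_order_ideal[of "[_]"]]
      by (intro order_ideal_sum) simp
    finally have "f - (\<Sum>j<Suc k. h' j) \<in> order_ideal (Suc k)" .
    moreover have "h' j \<in> hom_germs j" for j
    proof (cases j)
      case (Suc m)
      have "h i m * germ_coord i \<in> hom_germs j" for i
        using hom_germs_mult[OF h(1) germ_monom_in_hom_germs[of "[i]"]] Suc by simp
      then show ?thesis by (auto simp: h'_def Suc intro!: subspace_sum subspace_hom_germs)
    qed (auto simp: h'_def hom_germs_0_iff)
    ultimately show ?case by blast
  qed
  then obtain h where h: "\<And>j. h j \<in> hom_germs j" "f - (\<Sum>j<k. h j) \<in> order_ideal k" by blast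
  have "taylor_component j f = h j" if "j < k" for j
  proof -
    have "taylor_component j (f - (\<Sum>j<k. h j)) = 0"
      using taylor_component_order_ideal h(2) that by blast
    moreover have "taylor_component j (\<Sum>j<k. h j) = h j"
      using that by (simp add: taylor_component_sum taylor_component_hom_germs[OF h(1)])
    ultimately show ?thesis by (simp add: taylor_component_diff)
  qed
  with h(2) show ?thesis by simp
qed

lemma order_ideal_iff: "f \<in> order_ideal k \<longleftrightarrow> (\<forall>j<k. taylor_component j f = 0)"
proof
  assume "\<forall>j<k. taylor_component j f = 0"
  then show "f \<in> order_ideal k" using taylor_theorem[of f k] by simp
qed (auto intro: taylor_component_order_ideal)

text \<open>Terms of \<open>a\<close> of degree above \<open>k\<close> cannot reach degree
  \<open>k\<close> in the product, so \<open>a\<close> may be replaced by its Taylor polynomial, for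
  which the product splits into homogeneous pieces.\<close>

lemma taylor_component_mult_hom:
  assumes p: "p \<in> hom_germs e"
  shows "taylor_component k (a * p) = (if e \<le> k then taylor_component (k - e) a * p else 0)"
proof -
  define r where "r = a - (\<Sum>i<Suc k. taylor_component i a)"
  have "r * p \<in> order_ideal (Suc k)" unfolding r_def by (intro order_ideal_mult' taylor_theorem)
  then have "taylor_component k (r * p) = 0" by (rule taylor_component_order_ideal) simp
  then have "taylor_component k (a * p) = taylor_component k ((\<Sum>i<Suc k. taylor_component i a) * p)"
    by (simp add: r_def left_diff_distrib taylor_component_diff)
  also have "\<dots> = (\<Sum>i<Suc k. if k = i + e then taylor_component i a * p else 0)"
    unfolding sum_distrib_right taylor_component_sum
    by (intro sum.cong refl taylor_component_hom_germs hom_germs_mult taylor_component_in_hom_germs p)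
  also have "\<dots> = (\<Sum>i<Suc k. if i = k - e then if e \<le> k then taylor_component (k - e) a * p else 0 else 0)"
    by (intro sum.cong) auto
  finally show ?thesis by (simp add: sum.delta)
qed

section \<open>Ideals with given initial forms\<close>

lemma dependent_modulo:
  fixes v :: "nat \<Rightarrow> 'a::real_vector"
  assumes W: "subspace W" and B: "finite B" "\<And>v. \<exists>c. v - (\<Sum>b\<in>B. c b *\<^sub>R b) \<in> W"
  obtains c k where "k \<le> card B" "c k \<noteq> 0" "(\<Sum>i\<le>card B. c i *\<^sub>R v i) \<in> W"
proof -
  obtain a where a: "\<And>v. v - (\<Sum>b\<in>B. a v b *\<^sub>R b) \<in> W" using B(2) by metis
  define P where "P v = (\<Sum>b\<in>B. a v b *\<^sub>R b)" for v
  have P: "v - P v \<in> W" for v using a by (simp add: P_def)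
  let ?m = "card B"
  have "\<exists>c. (\<exists>k\<le>?m. c k \<noteq> 0) \<and> (\<Sum>i\<le>?m. c i *\<^sub>R P (v i)) = 0"
  proof (cases "inj_on (P \<circ> v) {..?m}")
    case True
    have "(P \<circ> v) ` {..?m} \<subseteq> span B" by (rule image_subsetI) (simp add: P_def span_sum span_scale span_base)
    then have "dependent ((P \<circ> v) ` {..?m})"
      using independent_span_bound[OF B(1), of "(P \<circ> v) ` {..?m}"] card_image[OF True] by fastforce
    then obtain u where u: "\<exists>y\<in>(P \<circ> v) ` {..?m}. u y \<noteq> 0" "(\<Sum>y\<in>(P \<circ> v) ` {..?m}. u y *\<^sub>R y) = 0"
      by (auto simp: dependent_finite)
    from u(2) have "(\<Sum>i\<le>?m. u (P (v i)) *\<^sub>R P (v i)) = 0"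
      by (subst (asm) sum.reindex[OF True]) (simp add: o_def)
    with u(1) show ?thesis
      by (intro exI[of _ "u \<circ> P \<circ> v"]) auto
  next
    case False
    then obtain i j where ij: "i \<le> ?m" "j \<le> ?m" "i \<noteq> j" "P (v i) = P (v j)" by (auto simp: inj_on_def)
    let ?c = "\<lambda>k. if k = i then 1 else if k = j then - 1 else (0::real)"
    have "(\<Sum>k\<le>?m. ?c k *\<^sub>R P (v k)) = (\<Sum>k\<in>{i, j}. ?c k *\<^sub>R P (v k))"
      using ij by (intro sum.mono_neutral_right) auto
    then show ?thesis using ij by (intro exI[of _ ?c]) auto
  qed
  then obtain c k where c: "k \<le> ?m" "c k \<noteq> 0" "(\<Sum>i\<le>?m. c i *\<^sub>R P (v i)) = 0" by blast
  have "(\<Sum>i\<le>?m. c i *\<^sub>R (v i - P (v i))) \<in> W"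
    by (intro subspace_sum[OF W] subspace_scale[OF W] P)
  then have "(\<Sum>i\<le>?m. c i *\<^sub>R v i) \<in> W" using c(3) by (simp add: scaleR_diff_right sum_subtractf)
  with c that show thesis by blast
qed

text \<open>The basis is sought inside \<open>G\<close> because it will be chosen among monomials,
  on whose homogeneity the comparison of the two ideals depends. It grows by \<open>x\<close>
  exactly when \<open>x\<close> is not yet a combination modulo \<open>W\<close>.\<close>

lemma basis_modulo_exists:
  fixes G :: "'a::real_vector set"
  assumes W: "subspace W" and G: "finite G"
  shows "\<exists>B\<subseteq>G. (\<forall>c. (\<Sum>b\<in>B. c b *\<^sub>R b) \<in> W \<longrightarrow> (\<forall>b\<in>B. c b = 0)) \<and>
    (\<forall>v\<in>G. \<exists>c. v - (\<Sum>b\<in>B. c b *\<^sub>R b) \<in> W)"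
  using G
proof (induction G rule: finite_induct)
  case (insert x G)
  then obtain B where B: "B \<subseteq> G" "\<And>c b. (\<Sum>b\<in>B. c b *\<^sub>R b) \<in> W \<Longrightarrow> b \<in> B \<Longrightarrow> c b = 0"
    "\<And>v. v \<in> G \<Longrightarrow> \<exists>c. v - (\<Sum>b\<in>B. c b *\<^sub>R b) \<in> W" by blast
  show ?case
  proof (cases "\<exists>c. x - (\<Sum>b\<in>B. c b *\<^sub>R b) \<in> W")
    case True
    with B show ?thesis by (intro exI[of _ B]) auto
  next
    case False
    have fin: "finite B" "x \<notin> B" using B(1) insert.hyps finite_subset by auto
    have "c b = 0" if c: "(\<Sum>b\<in>insert x B. c b *\<^sub>R b) \<in> W" and b: "b \<in> insert x B" for c b
    proof -
      have sum: "c x *\<^sub>R x + (\<Sum>b\<in>B. c b *\<^sub>R b) \<in> W" using c fin by simp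
      have "c x = 0"
      proof (rule ccontr)
        assume nz: "c x \<noteq> 0"
        have "(1 / c x) *\<^sub>R (c x *\<^sub>R x + (\<Sum>b\<in>B. c b *\<^sub>R b)) \<in> W" using sum by (rule subspace_scale[OF W])
        then have "x - (\<Sum>b\<in>B. (- c b / c x) *\<^sub>R b) \<in> W"
          using nz by (simp add: scaleR_add_right scaleR_sum_right sum_negf)
        then show False using False by (metis (no_types))
      qed
      then show ?thesis using sum B(2)[of c] b by auto
    qed
    moreover have "\<exists>c. v - (\<Sum>b\<in>insert x B. c b *\<^sub>R b) \<in> W" if v: "v \<in> insert x G" for v
    proof (cases "v = x")
      case True
      have "(\<Sum>b\<in>B. (if b = x then 1 else 0) *\<^sub>R b) = 0" using fin by (intro sum.neutral) auto
      then show ?thesis using True fin subspace_0[OF W] by (intro exI[of _ "\<lambda>b. if b = x then 1 else 0"]) simp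
    next
      case False
      then obtain c where c: "v - (\<Sum>b\<in>B. c b *\<^sub>R b) \<in> W" using B(3) v by blast
      have "(\<Sum>b\<in>B. (if b = x then 0 else c b) *\<^sub>R b) = (\<Sum>b\<in>B. c b *\<^sub>R b)" using fin by (intro sum.cong) auto
      then show ?thesis using c fin by (intro exI[of _ "\<lambda>b. if b = x then 0 else c b"]) simp
    qed
    ultimately show ?thesis using B(1) by (intro exI[of _ "insert x B"]) blast
  qed
qed simp

section \<open>Divisibility of monomials and Nakayama's lemma\<close>

lemma coord_power_count_dvd_monom: "germ_coord i ^ count_list w i dvd germ_monom w"
  by (induction w) (auto intro: mult_dvd_mono)

lemma germ_monom_replicate: "germ_monom (replicate k i) = germ_coord i ^ k"
  by (induction k) simp_all

lemma sum_count_list: "(\<Sum>i\<in>UNIV. count_list w i) = length (w :: 'n::finite list)"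
  by (simp add: sum_count_set)

text \<open>Pigeonhole: a word as long as the sum of all \<open>N i\<close> contains some letter
  \<open>i\<close> at least \<open>N i\<close> times.\<close>

lemma order_ideal_subset_ideal_generated:
  assumes "\<And>i. germ_coord i ^ N i \<in> ideal_generated S"
  shows "order_ideal (\<Sum>i\<in>UNIV. N i) \<subseteq> ideal_generated S"
  unfolding order_ideal_def
proof (rule ideal_generated_least, safe)
  fix w :: "'a list" assume len: "length w = (\<Sum>i\<in>UNIV. N i)"
  have "\<exists>i. N i \<le> count_list w i"
  proof (rule ccontr)
    assume "\<not> ?thesis"
    then have "(\<Sum>i\<in>UNIV. count_list w i) < (\<Sum>i\<in>UNIV. N i)"
      by (intro sum_strict_mono) (auto simp: not_le)
    then show False using len by (simp add: sum_count_list)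
  qed
  then obtain i where "N i \<le> count_list w i" ..
  then have "germ_coord i ^ N i dvd germ_monom w"
    using coord_power_count_dvd_monom le_imp_power_dvd dvd_trans by blast
  then show "germ_monom w \<in> ideal_generated S"
    using assms[of i] by (auto elim!: dvdE intro: ideal_generated_mult')
qed

text \<open>A monomial of degree \<open>k + 1\<close> is a coordinate times one of degree
  \<open>k\<close>, and the coordinate supplies the vanishing value. The sum runs over monomials as
  germs, not over words, as \<open>germ_nakayama\<close> expects.\<close>

lemma order_ideal_Suc_eq_sum:
  assumes "r \<in> order_ideal (Suc k)"
  shows "\<exists>m. (\<forall>y. germ_value (m y) = 0) \<and> r = (\<Sum>y\<in>{germ_monom w | w. length w = k}. m y * y)"
  using assms unfolding order_ideal_def
proof (induction rule: ideal_generated_induct)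
  case zero
  show ?case by (intro exI[of _ "\<lambda>_. 0"]) simp
next
  case (add x y)
  then obtain m m' where "\<forall>y. germ_value (m y) = 0" "x = (\<Sum>y\<in>{germ_monom w | w. length w = k}. m y * y)"
    "\<forall>y. germ_value (m' y) = 0" "y = (\<Sum>y\<in>{germ_monom w | w. length w = k}. m' y * y)" by blast
  then show ?case
    by (intro exI[of _ "\<lambda>y. m y + m' y"]) (simp add: germ_value_add distrib_right sum.distrib)
next
  case (mult a x)
  then obtain i w where w: "x = germ_coord i * germ_monom w" "length w = k" by (auto simp: length_Suc_conv)
  have fin: "finite {germ_monom w | w :: 'a list. length w = k}"
    using finite_lists_length_eq[of "UNIV :: 'a set" k] by simp
  show ?case
    using w fin
    by (intro exI[of _ "\<lambda>y. if y = germ_monom w then a * germ_coord i else 0"])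
       (auto simp: germ_value_mult if_distrib[of "\<lambda>c. c * _"] mult.assoc cong: if_cong)
qed

text \<open>Gaussian elimination: \<open>1 - m x x\<close> is a unit, so \<open>x\<close> can be
  solved for modulo \<open>S\<close> and substituted into the other relations, whose coefficients
  keep value zero.\<close>

lemma germ_nakayama:
  assumes "finite G" "\<And>x. x \<in> G \<Longrightarrow> x - (\<Sum>y\<in>G. m x y * y) \<in> ideal_generated S"
    "\<And>x y. germ_value (m x y) = 0"
  shows "G \<subseteq> ideal_generated S"
  using assms
proof (induction G arbitrary: m rule: finite_induct)
  case (insert x G)
  have "germ_value (1 - m x x) \<noteq> 0" by (simp add: germ_value_minus insert.prems)
  then obtain u where u: "(1 - m x x) * u = 1" using germ_inverse by blast
  define s where "s = (\<Sum>y\<in>G. u * m x y * y)"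
  have "x - (\<Sum>y\<in>insert x G. m x y * y) \<in> ideal_generated S" by (rule insert.prems) simp
  then have "u * (x - (\<Sum>y\<in>insert x G. m x y * y)) \<in> ideal_generated S" by (rule ideal_generated_mult)
  also have "u * (x - (\<Sum>y\<in>insert x G. m x y * y)) = (1 - m x x) * u * x - s"
    using insert.hyps by (simp add: s_def sum_distrib_left algebra_simps)
  finally have x: "x - s \<in> ideal_generated S" by (simp add: u)
  have "G \<subseteq> ideal_generated S"
  proof (rule insert.IH)
    fix z assume z: "z \<in> G"
    have "z - (\<Sum>y\<in>insert x G. m z y * y) \<in> ideal_generated S" using z by (intro insert.prems) simp
    then have "(z - (\<Sum>y\<in>insert x G. m z y * y)) + m z x * (x - s) \<in> ideal_generated S"
      using ideal_generated_mult[OF x] by (rule ideal_generated_add)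
    also have "(z - (\<Sum>y\<in>insert x G. m z y * y)) + m z x * (x - s) =
        z - (\<Sum>y\<in>G. (m z y + m z x * u * m x y) * y)"
      using insert.hyps by (simp add: s_def sum_distrib_left sum.distrib algebra_simps)
    finally show "z - (\<Sum>y\<in>G. (m z y + m z x * u * m x y) * y) \<in> ideal_generated S" .
  qed (simp add: germ_value_add germ_value_mult insert.prems)
  moreover from this have "s \<in> ideal_generated S"
    unfolding s_def by (intro ideal_generated_sum ideal_generated_mult) auto
  from ideal_generated_add[OF x this] have "x \<in> ideal_generated S" by simp
  ultimately show ?case by simp
qed simp

lemma taylor_component_minus_in_order_ideal:
  "f \<in> order_ideal k \<Longrightarrow> f - taylor_component k f \<in> order_ideal (Suc k)"
  by (auto simp: order_ideal_iff taylor_component_diff less_Suc_eq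
      taylor_component_hom_germs[OF taylor_component_in_hom_germs])

text \<open>To be instantiated with the partial derivatives of a leading component and of the germ.
  Indexing by the variables makes the number of generators equal to the number of coordinates, as
  \<open>koszul_exact_regular\<close> requires.\<close>

locale initial_forms =
  fixes p q :: "'n::finite \<Rightarrow> 'n germ" and e :: nat
  assumes p_hom: "\<And>i. p i \<in> hom_germs e" and q_p: "\<And>i. q i - p i \<in> order_ideal (Suc e)"
begin

abbreviation "P \<equiv> ideal_generated (range p)"
abbreviation "Q \<equiv> ideal_generated (range q)"

lemma taylor_component_in_P: "f \<in> P \<Longrightarrow> taylor_component k f \<in> P"
proof -
  assume "f \<in> P"
  then obtain a where "f = (\<Sum>i\<in>UNIV. a i * p i)" by (auto simp: in_ideal_generated_range)
  moreover have "taylor_component k (a i * p i) \<in> P" for a i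
    by (simp add: taylor_component_mult_hom[OF p_hom] ideal_generated_mult ideal_generated_base)
  ultimately show ?thesis by (simp add: taylor_component_sum ideal_generated_sum)
qed

text \<open>In a finite-dimensional quotient the powers of a coordinate satisfy a nontrivial
  relation modulo \<open>P\<close>. As \<open>P\<close> is homogeneous, each term of the relation
  lies in \<open>P\<close> by itself.\<close>

lemma coord_power_in_P:
  assumes "quotient_basis P B" shows "\<exists>N. germ_coord i ^ N \<in> P"
proof -
  have B: "finite B" "\<exists>c. v - (\<Sum>b\<in>B. c b *\<^sub>R b) \<in> P" for v
    using assms by (auto simp: quotient_basis_def)
  obtain c k where c: "k \<le> card B" "c k \<noteq> 0" "(\<Sum>j\<le>card B. c j *\<^sub>R germ_coord i ^ j) \<in> P"
    using dependent_modulo[OF subspace_ideal_generated B, where v = "\<lambda>j. germ_coord i ^ j"] by blast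
  have x: "germ_coord i ^ j \<in> hom_germs j" for j
    using germ_monom_in_hom_germs[of "replicate j i"] by (simp add: germ_monom_replicate)
  have "taylor_component k (\<Sum>j\<le>card B. c j *\<^sub>R germ_coord i ^ j) = c k *\<^sub>R germ_coord i ^ k"
    using c(1) by (simp add: taylor_component_sum taylor_component_scaleR taylor_component_hom_germs[OF x]
        if_distrib[of "\<lambda>v. _ *\<^sub>R v"] cong: if_cong)
  with taylor_component_in_P[OF c(3)] have "c k *\<^sub>R germ_coord i ^ k \<in> P" by metis
  from ideal_generated_scaleR[OF this, of "1 / c k"] c(2) show ?thesis by auto
qed

text \<open>The coefficients of a homogeneous element can be taken homogeneous of degree
  \<open>k - e\<close>; replacing \<open>p\<close> by \<open>q\<close> then changes only higher
  orders. For \<open>k < e\<close> the element is zero.\<close>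

lemma hom_in_P:
  assumes h: "h \<in> P" "h \<in> hom_germs k"
  shows "\<exists>g\<in>Q. h - g \<in> order_ideal (Suc k)"
proof -
  obtain a where a: "h = (\<Sum>i\<in>UNIV. a i * p i)" using h(1) by (auto simp: in_ideal_generated_range)
  have "h = taylor_component k h" using h(2) by (simp add: taylor_component_hom_germs)
  also have "\<dots> = (if e \<le> k then \<Sum>i\<in>UNIV. taylor_component (k - e) (a i) * p i else 0)"
    by (simp add: a taylor_component_sum taylor_component_mult_hom[OF p_hom])
  finally have eq: "h = (if e \<le> k then \<Sum>i\<in>UNIV. taylor_component (k - e) (a i) * p i else 0)" .
  show ?thesis
  proof (cases "e \<le> k")
    case False
    with eq show ?thesis by (intro bexI[of _ 0]) auto
  next
    case True
    define g where "g = (\<Sum>i\<in>UNIV. taylor_component (k - e) (a i) * q i)"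
    have "taylor_component (k - e) (a i) * (q i - p i) \<in> order_ideal (Suc k)" for i
      using order_ideal_mult_order_ideal[OF subsetD[OF hom_germs_subset_order_ideal
          taylor_component_in_hom_germs[of "k - e" "a i"]] q_p[of i]] True by simp
    then have "(\<Sum>i\<in>UNIV. taylor_component (k - e) (a i) * (q i - p i)) \<in> order_ideal (Suc k)"
      by (rule order_ideal_sum)
    then have "g - h \<in> order_ideal (Suc k)"
      using eq True by (simp add: g_def right_diff_distrib sum_subtractf)
    then have "h - g \<in> order_ideal (Suc k)"
      using order_ideal_diff[of 0 "Suc k" "g - h"] by simp
    moreover have "g \<in> Q"
      unfolding g_def by (intro ideal_generated_sum ideal_generated_mult ideal_generated_base) auto
    ultimately show ?thesis by blast
  qed
qed

text \<open>By \<open>hom_in_P\<close> each monomial of degree \<open>k\<close> lies in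
  \<open>Q\<close> up to order \<open>k + 1\<close>, that is, up to combinations of the same
  monomials with coefficients vanishing at \<open>0\<close>. Nakayama's lemma removes the whole
  error at once, flat parts included.\<close>

lemma order_ideal_subset_Q:
  assumes "order_ideal k \<subseteq> P" shows "order_ideal k \<subseteq> Q"
proof -
  let ?G = "{germ_monom w | w :: 'n list. length w = k}"
  have ex: "\<exists>m. (\<forall>y. germ_value (m y) = 0) \<and> x - (\<Sum>y\<in>?G. m y * y) \<in> Q" if "x \<in> ?G" for x
  proof -
    from that have "x \<in> P" "x \<in> hom_germs k"
      using assms germ_monom_in_order_ideal germ_monom_in_hom_germs by auto
    then obtain g where g: "g \<in> Q" "x - g \<in> order_ideal (Suc k)" using hom_in_P by blast
    obtain m where "\<forall>y. germ_value (m y) = 0" "x - g = (\<Sum>y\<in>?G. m y * y)"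
      using order_ideal_Suc_eq_sum[OF g(2)] by blast
    moreover from this(2) have "x - (\<Sum>y\<in>?G. m y * y) = g" by (simp add: algebra_simps)
    ultimately show ?thesis using g(1) by blast
  qed
  \<comment> \<open>The coefficients are made total, zero outside the monomials, because
    \<open>germ_nakayama\<close> asks for vanishing values at all arguments.\<close>
  have "\<forall>x. \<exists>m. (\<forall>y. germ_value (m y) = 0) \<and> (x \<in> ?G \<longrightarrow> x - (\<Sum>y\<in>?G. m y * y) \<in> Q)"
  proof (intro allI)
    fix x
    show "\<exists>m. (\<forall>y. germ_value (m y) = 0) \<and> (x \<in> ?G \<longrightarrow> x - (\<Sum>y\<in>?G. m y * y) \<in> Q)"
    proof (cases "x \<in> ?G")
      case False
      then show ?thesis by (intro exI[of _ "\<lambda>_. 0"]) (simp del: mem_Collect_eq)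
    qed (use ex in blast)
  qed
  from choice[OF this] obtain m
    where m: "\<forall>x. (\<forall>y. germ_value (m x y) = 0) \<and> (x \<in> ?G \<longrightarrow> x - (\<Sum>y\<in>?G. m x y * y) \<in> Q)" ..
  have "finite ?G" using finite_lists_length_eq[of "UNIV :: 'n set" k] by simp
  then have "?G \<subseteq> Q" by (rule germ_nakayama[where m = m]) (use m in blast)+
  then show ?thesis unfolding order_ideal_def by (rule ideal_generated_least)
qed

lemma koszul_d_p_in_order_ideal:
  "(\<And>v. z v \<in> order_ideal r) \<Longrightarrow> koszul_d (map p xs) z w \<in> order_ideal (r + e)"
proof (induction xs arbitrary: z w)
  case (Cons i xs)
  have "p i \<in> order_ideal e" using p_hom hom_germs_subset_order_ideal by blast
  from order_ideal_mult_order_ideal[OF Cons.prems this]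
  have "p i * z v \<in> order_ideal (r + e)" for v by (simp add: mult.commute)
  with Cons show ?case
    by (cases w) (auto intro!: order_ideal_add order_ideal_diff[of 0, simplified])
qed simp

lemma koszul_d_q_diff_p:
  "(\<And>v. z v \<in> order_ideal r) \<Longrightarrow>
    koszul_d (map q xs) z w - koszul_d (map p xs) z w \<in> order_ideal (r + Suc e)"
proof (induction xs arbitrary: z w)
  case (Cons i xs)
  show ?case
  proof (cases w)
    case w: (Cons b w')
    have IH: "koszul_d (map q xs) (\<lambda>v. z (b # v)) w' - koszul_d (map p xs) (\<lambda>v. z (b # v)) w'
        \<in> order_ideal (r + Suc e)" by (intro Cons)
    show ?thesis
    proof (cases b)
      case True
      then show ?thesis using order_ideal_diff[OF zero_in_order_ideal IH] w by simp
    next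
      case False
      have "z (True # w') * (q i - p i) \<in> order_ideal (r + Suc e)"
        by (intro order_ideal_mult_order_ideal Cons.prems q_p)
      from order_ideal_add[OF IH this] show ?thesis using w False by (simp add: algebra_simps)
    qed
  qed simp
qed simp

lemma taylor_component_koszul_d:
  "taylor_component k (koszul_d (map p xs) z w) =
     (if e \<le> k then koszul_d (map p xs) (\<lambda>v. taylor_component (k - e) (z v)) w else 0)"
proof (induction xs arbitrary: z w)
  case (Cons i xs)
  show ?case
  proof (cases w)
    case w: (Cons b w')
    have "taylor_component k (- f) = - taylor_component k f" for f :: "'n germ"
      using taylor_component_diff[of k 0 f] by simp
    moreover have "taylor_component k (p i * f) = (if e \<le> k then p i * taylor_component (k - e) f else 0)" for f
      using taylor_component_mult_hom[OF p_hom, of k f i] by (simp add: mult.commute)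
    ultimately show ?thesis using w Cons.IH by (simp add: taylor_component_add)
  qed simp
qed simp

text \<open>A representation \<open>v = \<Sum> z\<^sub>i q\<^sub>i\<close> with \<open>z\<^sub>i\<close> of order \<open>\<ge> r\<close> can be improved to one of order
  \<open>> r\<close> when the component of \<open>v\<close> of degree \<open>r + e\<close> vanishes: then the leading parts of the
  \<open>z\<^sub>i\<close> form a syzygy of \<open>p\<close>, hence a Koszul syzygy, and subtracting the same Koszul syzygy of
  \<open>q\<close> does not change \<open>v\<close>.\<close>

lemma improve_order:
  assumes ex: "koszul_exact (map p xs) {} 1"
    and v: "v = koszul_d (map q xs) z (replicate (length xs) False)" and z: "\<And>w. z w \<in> order_ideal r"
    and T: "taylor_component (r + e) v = 0"
  shows "\<exists>z'. v = koszul_d (map q xs) z' (replicate (length xs) False) \<and> (\<forall>w. z' w \<in> order_ideal (Suc r))"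
proof -
  let ?F = "replicate (length xs) False"
  define z1 where "z1 w = taylor_component r (z w)" for w
  have "taylor_component (r + e) (v - koszul_d (map p xs) z ?F) = 0"
    using koszul_d_q_diff_p[of z r, OF z] taylor_component_order_ideal v by fastforce
  then have "koszul_d (map p xs) z1 ?F = 0"
    using T by (simp add: taylor_component_diff taylor_component_koszul_d z1_def[abs_def])
  moreover have "w = ?F" if "length w = length xs" "count_list w True = 0" for w
    using that by (intro replicate_eqI) (auto simp: count_list_0_iff)
  ultimately obtain u where u: "\<And>w. w \<in> bool_words (length xs) 1 \<Longrightarrow> z1 w = koszul_d (map p xs) u w"
    using ex[unfolded koszul_exact_def, rule_format, of z1] by (auto simp: ideal_generated_empty)
  \<comment> \<open>\<open>u\<close> need not be homogeneous; its component of degree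
    \<open>r - e\<close> is enough, because the differential raises degrees by \<open>e\<close> and
    \<open>z1\<close> has degree \<open>r\<close>. For \<open>r < e\<close> this forces
    \<open>z1 = 0\<close> in degree one, and the correction is zero.\<close>
  define s where "s w = (if e \<le> r then taylor_component (r - e) (u w) else 0)" for w
  have s: "z1 w = koszul_d (map p xs) s w" if "w \<in> bool_words (length xs) 1" for w
  proof -
    have "z1 w = taylor_component r (z1 w)"
      by (simp add: z1_def taylor_component_hom_germs[OF taylor_component_in_hom_germs])
    then show ?thesis
      using u[OF that] by (simp add: taylor_component_koszul_d s_def[abs_def] koszul_d_0 split: if_splits)
  qed
  have s': "koszul_d (map q xs) s w - koszul_d (map p xs) s w \<in> order_ideal (Suc r)" for w
  proof (cases "e \<le> r")
    case True
    then have "s v \<in> order_ideal (r - e)" for v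
      using hom_germs_subset_order_ideal taylor_component_in_hom_germs by (auto simp: s_def)
    from koszul_d_q_diff_p[OF this] True show ?thesis by simp
  qed (simp add: s_def[abs_def] koszul_d_0)
  \<comment> \<open>Off the words of degree one nothing is known about the difference, so the value
    is set to zero there; the differential at \<open>?F\<close> does not see it.\<close>
  define z' where "z' w = (if w \<in> bool_words (length xs) 1 then z w - koszul_d (map q xs) s w else 0)" for w
  have "z' w \<in> order_ideal (Suc r)" for w
  proof (cases "w \<in> bool_words (length xs) 1")
    case True
    have "(z w - z1 w) - (koszul_d (map q xs) s w - koszul_d (map p xs) s w) \<in> order_ideal (Suc r)"
      unfolding z1_def by (intro order_ideal_diff taylor_component_minus_in_order_ideal z s')
    then show ?thesis unfolding z'_def using True s[OF True] by simp
  qed (auto simp: z'_def)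
  moreover have "koszul_d (map q xs) z' ?F = koszul_d (map q xs) (\<lambda>w. z w - koszul_d (map q xs) s w) ?F"
    by (rule koszul_d_cong) (auto simp: z'_def count_list_0_iff)
  then have "v = koszul_d (map q xs) z' ?F"
    by (simp add: v koszul_d_diff koszul_d_d)
  ultimately show ?thesis by blast
qed

theorem quotient_dim_eq:
  assumes fin: "quotient_basis P B0"
  shows "quotient_dim Q = quotient_dim P"
proof -
  obtain N where N: "\<And>i. germ_coord i ^ N i \<in> P" using coord_power_in_P[OF fin] by metis
  \<comment> \<open>Every monomial of degree \<open>K\<close> contains some
    \<open>germ_coord i ^ N i\<close>, so \<open>P\<close>, and by Nakayama also \<open>Q\<close>,
    contains all germs of order \<open>K\<close>; only lower degrees remain to be compared.\<close>
  define K where "K = (\<Sum>i\<in>UNIV. N i)"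
  have K_P: "order_ideal K \<subseteq> P"
    unfolding K_def by (rule order_ideal_subset_ideal_generated) (rule N)
  then have K_Q: "order_ideal K \<subseteq> Q" by (rule order_ideal_subset_Q)
  let ?G = "germ_monom ` {w :: 'n list. length w < K}"
  have "finite {w :: 'n list. length w < K}"
    by (rule finite_subset[OF _ finite_lists_length_le[of UNIV K]]) auto
  then have "finite ?G" by simp
  from basis_modulo_exists[OF subspace_ideal_generated this, of "range p"]
  obtain B where B: "B \<subseteq> ?G"
      and "\<forall>c. (\<Sum>b\<in>B. c b *\<^sub>R b) \<in> P \<longrightarrow> (\<forall>b\<in>B. c b = 0)"
      and "\<forall>v\<in>?G. \<exists>c. v - (\<Sum>b\<in>B. c b *\<^sub>R b) \<in> P"
    by blast
  then have indep: "(\<Sum>b\<in>B. c b *\<^sub>R b) \<in> P \<Longrightarrow> b \<in> B \<Longrightarrow> c b = 0"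
      and spans: "v \<in> ?G \<Longrightarrow> \<exists>c. v - (\<Sum>b\<in>B. c b *\<^sub>R b) \<in> P" for c b v
    by blast+
  have finB: "finite B" using B \<open>finite ?G\<close> finite_subset by blast
  have B_hom: "\<exists>k<K. b \<in> hom_germs k" if "b \<in> B" for b
    using B that germ_monom_in_hom_germs by blast
  \<comment> \<open>Elements of \<open>B\<close> are homogeneous, so a Taylor component fixes or
    kills each of them and merely masks the coefficients of a combination.\<close>
  have T_B: "taylor_component k (\<Sum>b\<in>B. c b *\<^sub>R b) =
      (\<Sum>b\<in>B. (if taylor_component k b = b then c b else 0) *\<^sub>R b)" for k c
    proof -
    have "taylor_component k b = b \<or> taylor_component k b = 0" if "b \<in> B" for b
      using B_hom[OF that] taylor_component_hom_germs by metis
    then show ?thesis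
      unfolding taylor_component_sum taylor_component_scaleR by (intro sum.cong) auto
  qed
  have spanB: "v \<in> {x + y | x y. x \<in> span B \<and> y \<in> W} \<longleftrightarrow> (\<exists>c. v - (\<Sum>b\<in>B. c b *\<^sub>R b) \<in> W)" for v W
  proof
    assume "v \<in> {x + y | x y. x \<in> span B \<and> y \<in> W}"
    then obtain c y where "v = (\<Sum>b\<in>B. c b *\<^sub>R b) + y" "y \<in> W" by (auto simp: span_finite[OF finB])
    then show "\<exists>c. v - (\<Sum>b\<in>B. c b *\<^sub>R b) \<in> W" by (intro exI[of _ c]) simp
  next
    assume "\<exists>c. v - (\<Sum>b\<in>B. c b *\<^sub>R b) \<in> W"
    then obtain c where c: "v - (\<Sum>b\<in>B. c b *\<^sub>R b) \<in> W" ..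
    have "v = (\<Sum>b\<in>B. c b *\<^sub>R b) + (v - (\<Sum>b\<in>B. c b *\<^sub>R b))" by simp
    moreover have "(\<Sum>b\<in>B. c b *\<^sub>R b) \<in> span B" by (intro span_sum span_scale span_base)
    ultimately show "v \<in> {x + y | x y. x \<in> span B \<and> y \<in> W}" using c by blast
  qed
  define SP where "SP = {x + y | x y. x \<in> span B \<and> y \<in> P}"
  define SQ where "SQ = {x + y | x y. x \<in> span B \<and> y \<in> Q}"
  have sub: "subspace SP" "subspace SQ"
    unfolding SP_def SQ_def by (intro subspace_sums subspace_span subspace_ideal_generated)+
  have hom_SP: "hom_germs k \<subseteq> SP" if "k < K" for k
    unfolding hom_germs_def
  proof (rule span_minimal[OF _ sub(1)], safe)
    fix w :: "'n list" assume "k = length w"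
    with that show "germ_monom w \<in> SP" unfolding SP_def spanB by (intro spans) auto
  qed
  have PSP: "P \<subseteq> SP" and QSQ: "Q \<subseteq> SQ"
    unfolding SP_def SQ_def by (force intro: span_zero)+
  have SP_UNIV: "v \<in> SP" for v
  proof -
    have "v - (\<Sum>j<K. taylor_component j v) \<in> SP" using taylor_theorem K_P PSP by blast
    moreover have "(\<Sum>j<K. taylor_component j v) \<in> SP"
      using hom_SP taylor_component_in_hom_germs by (intro subspace_sum[OF sub(1)]) blast
    ultimately have "(v - (\<Sum>j<K. taylor_component j v)) + (\<Sum>j<K. taylor_component j v) \<in> SP"
      by (rule subspace_add[OF sub(1)])
    then show ?thesis by simp
  qed
  have "quotient_basis P B"
    unfolding quotient_basis_def using finB indep SP_UNIV spanB by (auto simp: SP_def)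
  \<comment> \<open>Descending induction on the order, from \<open>K\<close>, where \<open>Q\<close>
    itself suffices, down to \<open>0\<close>.\<close>
  have order_SQ: "order_ideal (K - j) \<subseteq> SQ" if "j \<le> K" for j
    using that
  proof (induction j)
    case 0
    then show ?case using K_Q QSQ by auto
  next
    case (Suc j)
    define k where "k = K - Suc j"
    have IH: "order_ideal (Suc k) \<subseteq> SQ" using Suc by (simp add: k_def Suc_diff_Suc)
    show ?case
    proof (fold k_def, rule subsetI)
      fix f :: "'n germ" assume f: "f \<in> order_ideal k"
      obtain c where c: "taylor_component k f - (\<Sum>b\<in>B. c b *\<^sub>R b) \<in> P"
        using SP_UNIV[of "taylor_component k f"] spanB by (auto simp: SP_def)
      \<comment> \<open>Only the degree \<open>k\<close> part of the combination is kept; it is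
        again a combination over \<open>B\<close>, and the difference becomes homogeneous, as
        \<open>hom_in_P\<close> demands.\<close>
      define s where "s = taylor_component k (\<Sum>b\<in>B. c b *\<^sub>R b)"
      have "taylor_component k f - s \<in> P"
        using taylor_component_in_P[OF c, of k]
        by (simp add: s_def taylor_component_diff taylor_component_hom_germs[OF taylor_component_in_hom_germs])
      moreover have "taylor_component k f - s \<in> hom_germs k"
        unfolding s_def by (intro subspace_diff subspace_hom_germs taylor_component_in_hom_germs)
      ultimately obtain g where g: "g \<in> Q" "taylor_component k f - s - g \<in> order_ideal (Suc k)"
        using hom_in_P by blast
      have "s \<in> SQ"
        unfolding s_def T_B SQ_def spanB by (auto intro!: exI[of _ "\<lambda>b. if taylor_component k b = b then c b else 0"])
      moreover have "taylor_component k f - s - g \<in> SQ" using g(2) IH by blast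
      moreover have "f - taylor_component k f \<in> SQ"
        using taylor_component_minus_in_order_ideal[OF f] IH by blast
      ultimately have "(f - taylor_component k f) + (taylor_component k f - s - g) + s + g \<in> SQ"
        using g(1) QSQ by (intro subspace_add[OF sub(2)]) auto
      then show "f \<in> SQ" by simp
    qed
  qed
  have "v \<in> SQ" for v
    using order_SQ[of K] by (auto simp: order_ideal_0_eq_UNIV)
  moreover have "c b = 0" if v: "(\<Sum>b\<in>B. c b *\<^sub>R b) \<in> Q" and b: "b \<in> B" for c b
  proof -
    obtain xs where xs: "set xs = (UNIV :: 'n set)" "distinct xs"      using finite_distinct_list[of "UNIV :: 'n set"] by auto
    have ex: "koszul_exact (map p xs) {} 1"
      using koszul_exact_regular[of germ_coord "map p xs" "{}" 1] germ_coord_regular coord_power_in_P[OF fin] xs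
        distinct_card[OF xs(2)] by auto
    define v where "v = (\<Sum>b\<in>B. c b *\<^sub>R b)"
    let ?F = "replicate (length xs) False"
    \<comment> \<open>A component of \<open>v\<close> is a combination over \<open>B\<close> with
      masked coefficients; if it lies in \<open>P\<close>, these vanish by independence modulo
      \<open>P\<close>.\<close>
    have T: "taylor_component k v \<in> P \<Longrightarrow> taylor_component k v = 0 \<and>
      (\<forall>b\<in>B. taylor_component k b = b \<longrightarrow> c b = 0)" for k
    proof -
      assume "taylor_component k v \<in> P"
      then have zero: "b \<in> B \<Longrightarrow> (if taylor_component k b = b then c b else 0) = 0" for b
        unfolding v_def T_B by (rule indep)
      then have "\<forall>b\<in>B. taylor_component k b = b \<longrightarrow> c b = 0" by metis
      moreover have "taylor_component k v = 0"
        unfolding v_def T_B using zero by (intro sum.neutral) simp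
      ultimately show ?thesis by blast
    qed
    have "\<exists>z. v = koszul_d (map q xs) z ?F \<and> (\<forall>w. z w \<in> order_ideal r)" for r
    proof (induction r)
      case 0
      show ?case using ideal_generated_imp_koszul_d[of v "map q xs"] that xs
        by (auto simp: v_def order_ideal_0_eq_UNIV)
    next
      case (Suc r)
      then obtain z where z: "v = koszul_d (map q xs) z ?F" "\<And>w. z w \<in> order_ideal r" by blast
      \<comment> \<open>In degree \<open>r + e\<close> the generators \<open>q\<close> may be
        replaced by \<open>p\<close>; so this component of \<open>v\<close> lies in
        \<open>P\<close>, hence vanishes by \<open>T\<close>, as \<open>improve_order\<close>
        requires.\<close>
      have "taylor_component (r + e) (v - koszul_d (map p xs) z ?F) = 0"
        using koszul_d_q_diff_p[of z r, OF z(2)] taylor_component_order_ideal z(1) by fastforce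
      then have "taylor_component (r + e) v = koszul_d (map p xs) (\<lambda>w. taylor_component r (z w)) ?F"
        by (simp add: taylor_component_diff taylor_component_koszul_d)
      also have "\<dots> \<in> P" using koszul_d_in_ideal_generated[of "map p xs"] xs by simp
      finally show ?case using improve_order[OF ex z] T by blast
    qed
    \<comment> \<open>Order \<open>K\<close> suffices since every \<open>b\<close> has degree below
      \<open>K\<close>: the corresponding component of \<open>v\<close> is then zero, and
      \<open>T\<close> gives \<open>c b = 0\<close>.\<close>
    then obtain z where z: "v = koszul_d (map q xs) z ?F" "\<And>w. z w \<in> order_ideal K" by blast
    have "koszul_d (map p xs) z ?F + (koszul_d (map q xs) z ?F - koszul_d (map p xs) z ?F) \<in> order_ideal K"
      using koszul_d_p_in_order_ideal[of z K, OF z(2)] koszul_d_q_diff_p[of z K, OF z(2)]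
        order_ideal_antimono[of K "K + e"] order_ideal_antimono[of K "K + Suc e"]
      by (intro order_ideal_add) auto
    then have v: "v \<in> order_ideal K" by (simp add: z(1))
    obtain k where k: "k < K" "b \<in> hom_germs k" using B_hom b by blast
    have "taylor_component k v = 0" using taylor_component_order_ideal[OF v k(1)] .
    then show "c b = 0" using T[of k] b k(2) by (simp add: taylor_component_hom_germs)
  qed
  ultimately have "quotient_basis Q B"
    unfolding quotient_basis_def using finB spanB by (auto simp: SQ_def)
  with \<open>quotient_basis P B\<close> show ?thesis
    by (simp add: quotient_dim_eq_card[OF subspace_ideal_generated])
qed

end

section \<open>Comparison of initial parts\<close>

text \<open>A growth bound passes through composition with a map that is only once differentiable,
  whereas higher derivatives do not.\<close>

lift_definition germ_bigo :: "nat \<Rightarrow> 'n::finite germ \<Rightarrow> bool"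
  is "\<lambda>k f. \<exists>C. \<forall>\<^sub>F x in nhds 0. \<bar>f x\<bar> \<le> C * norm x ^ k"
proof -
  fix k and f g :: "real^'n \<Rightarrow> real"
  assume "germ_rel f g"
  then have eq: "\<forall>\<^sub>F x in nhds 0. f x = g x" by (simp add: germ_rel_def)
  have "(\<forall>\<^sub>F x in nhds 0. \<bar>f x\<bar> \<le> C * norm x ^ k) \<longleftrightarrow> (\<forall>\<^sub>F x in nhds 0. \<bar>g x\<bar> \<le> C * norm x ^ k)" for C
    by (rule eventually_subst) (use eq in eventually_elim, simp)
  then show "(\<exists>C. \<forall>\<^sub>F x in nhds 0. \<bar>f x\<bar> \<le> C * norm x ^ k) \<longleftrightarrow> (\<exists>C. \<forall>\<^sub>F x in nhds 0. \<bar>g x\<bar> \<le> C * norm x ^ k)"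
    by simp
qed

lemma germ_bigo_abs:
  "smooth_near_0 f \<Longrightarrow> germ_bigo k (abs_germ f) \<longleftrightarrow> (\<exists>C. \<forall>\<^sub>F x in nhds 0. \<bar>f x\<bar> \<le> C * norm x ^ k)"
  by (simp add: germ_bigo.abs_eq germ_rel_def)

lemma germ_bigo_add: "germ_bigo k f \<Longrightarrow> germ_bigo k g \<Longrightarrow> germ_bigo k (f + g)"
proof transfer
  fix k and f g :: "real^'a \<Rightarrow> real"
  assume "\<exists>C. \<forall>\<^sub>F x in nhds 0. \<bar>f x\<bar> \<le> C * norm x ^ k" "\<exists>C. \<forall>\<^sub>F x in nhds 0. \<bar>g x\<bar> \<le> C * norm x ^ k"
  then obtain C D where "\<forall>\<^sub>F x in nhds 0. \<bar>f x\<bar> \<le> C * norm x ^ k" "\<forall>\<^sub>F x in nhds 0. \<bar>g x\<bar> \<le> D * norm x ^ k"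
    by blast
  then have "\<forall>\<^sub>F x in nhds 0. \<bar>f x + g x\<bar> \<le> (C + D) * norm x ^ k"
    by eventually_elim (simp add: distrib_right)
  then show "\<exists>C. \<forall>\<^sub>F x in nhds 0. \<bar>f x + g x\<bar> \<le> C * norm x ^ k" ..
qed

lemma germ_bigo_mult: "germ_bigo i f \<Longrightarrow> germ_bigo j g \<Longrightarrow> germ_bigo (i + j) (f * g)"
proof transfer
  fix i j and f g :: "real^'a \<Rightarrow> real"
  assume "\<exists>C. \<forall>\<^sub>F x in nhds 0. \<bar>f x\<bar> \<le> C * norm x ^ i" "\<exists>C. \<forall>\<^sub>F x in nhds 0. \<bar>g x\<bar> \<le> C * norm x ^ j"
  then obtain C D where "\<forall>\<^sub>F x in nhds 0. \<bar>f x\<bar> \<le> C * norm x ^ i" "\<forall>\<^sub>F x in nhds 0. \<bar>g x\<bar> \<le> D * norm x ^ j"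
    by blast
  then have "\<forall>\<^sub>F x in nhds 0. \<bar>f x * g x\<bar> \<le> (C * D) * norm x ^ (i + j)"
  proof eventually_elim
    case (elim x)
    have "\<bar>f x\<bar> * \<bar>g x\<bar> \<le> (C * norm x ^ i) * (D * norm x ^ j)"
      using elim order_trans[OF abs_ge_zero elim(1)] by (intro mult_mono) auto
    then show ?case by (simp add: abs_mult power_add mult.assoc mult.left_commute)
  qed
  then show "\<exists>C. \<forall>\<^sub>F x in nhds 0. \<bar>f x * g x\<bar> \<le> C * norm x ^ (i + j)" ..
qed

lemma germ_bigo_0_right: "germ_bigo 0 f"
proof transfer
  fix f :: "real^'a \<Rightarrow> real" assume "germ_rel f f"
  then have "isCont f 0"
    using smooth_near_0_eventually_isCont eventually_nhds_x_imp_x by (fastforce simp: germ_rel_def)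
  then have "((\<lambda>x. \<bar>f x\<bar>) \<longlongrightarrow> \<bar>f 0\<bar>) (nhds 0)"
    by (intro tendsto_rabs) (simp add: continuous_at tendsto_at_iff_tendsto_nhds)
  then have "\<forall>\<^sub>F x in nhds 0. \<bar>f x\<bar> < \<bar>f 0\<bar> + 1" by (rule order_tendstoD) simp
  then have "\<forall>\<^sub>F x in nhds 0. \<bar>f x\<bar> \<le> (\<bar>f 0\<bar> + 1) * norm x ^ 0" by eventually_elim simp
  then show "\<exists>C. \<forall>\<^sub>F x in nhds 0. \<bar>f x\<bar> \<le> C * norm x ^ 0" ..
qed

lemma germ_bigo_zero: "germ_bigo k 0"
  by transfer (auto intro: exI[of _ 0])

lemma germ_bigo_coord: "germ_bigo 1 (germ_coord i)"
  by transfer (auto intro!: exI[of _ 1] eventuallyI component_le_norm_cart)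

lemma germ_bigo_monom: "germ_bigo (length w) (germ_monom w)"
proof (induction w)
  case (Cons a w)
  then show ?case using germ_bigo_mult[OF germ_bigo_coord Cons.IH] by simp
qed (simp add: germ_bigo_0_right)

lemma order_ideal_imp_germ_bigo:
  assumes "f \<in> order_ideal k" shows "germ_bigo k f"
  using assms unfolding order_ideal_def
proof (induction rule: ideal_generated_induct)
  case (mult a x)
  then show ?case using germ_bigo_mult[OF germ_bigo_0_right germ_bigo_monom] by auto
qed (auto simp: germ_bigo_zero germ_bigo_add)

text \<open>A germ has values only near \<open>0\<close>; scaling arguments need a representative
  that is homogeneous on the whole space.\<close>

lemma hom_germs_representative:
  assumes "f \<in> hom_germs k"
  obtains h where "smooth_near_0 h" "f = abs_germ h" "continuous_on UNIV h"
    "\<And>t x. h (t *\<^sub>R x) = t ^ k * h x"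
proof -
  let ?R = "\<lambda>k f h. smooth_near_0 h \<and> f = abs_germ h \<and> continuous_on UNIV h \<and> (\<forall>t x. h (t *\<^sub>R x) = t ^ k * h x)"
  have monom: "\<exists>h. ?R (length w) (germ_monom w) h" for w :: "'a list"
  proof (induction w)
    case Nil
    show ?case by (intro exI[of _ "\<lambda>x. 1"]) (simp add: smooth_near_0_const one_germ_def)
  next
    case (Cons a w)
    then obtain h where h: "?R (length w) (germ_monom w) h" by blast
    have "germ_monom (a # w) = germ_coord a * abs_germ h" using h by simp
    also have "\<dots> = abs_germ (\<lambda>x. x $ a * h x)"
      using h by (simp add: germ_coord_def times_germ.abs_eq germ_rel_def smooth_near_0_nth)
    finally show ?case
      using h by (intro exI[of _ "\<lambda>x. x $ a * h x"])
        (auto simp: smooth_near_0_mult smooth_near_0_nth intro!: continuous_intros)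
  qed
  have "\<exists>h. ?R k f h"
    using assms unfolding hom_germs_def
  proof (induction rule: span_induct_alt)
    case base
    show ?case by (intro exI[of _ "\<lambda>x. 0"]) (simp add: smooth_near_0_const zero_germ_def)
  next
    case (step c b y)
    then obtain h h' where "?R k b h" "?R k y h'" using monom by blast
    then show ?case
      by (intro exI[of _ "\<lambda>x. c * h x + h' x"])
         (auto simp: smooth_near_0_mult smooth_near_0_const smooth_near_0_add plus_germ.abs_eq
           scaleR_germ.abs_eq germ_rel_def algebra_simps intro!: continuous_intros)
  qed
  then show thesis using that by blast
qed

lemma eventually_at_right_line:
  assumes "\<forall>\<^sub>F x in nhds (0 :: real^'n). P x"
  shows "\<forall>\<^sub>F t in at_right 0. P (t *\<^sub>R x)"
proof -
  have "((\<lambda>t. t *\<^sub>R x) \<longlongrightarrow> 0) (at_right 0)" by (auto intro!: tendsto_eq_intros)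
  then show ?thesis using assms by (simp add: filterlim_iff)
qed

lemma germ_bigo_Suc_imp_germ_bigo: "germ_bigo (Suc k) f \<Longrightarrow> germ_bigo k f"
proof transfer
  fix k and f :: "real^'a \<Rightarrow> real"
  assume "\<exists>C. \<forall>\<^sub>F x in nhds 0. \<bar>f x\<bar> \<le> C * norm x ^ Suc k"
  then obtain C where C: "\<forall>\<^sub>F x in nhds 0. \<bar>f x\<bar> \<le> C * norm x ^ Suc k" ..
  have "\<forall>\<^sub>F x in nhds (0 :: real^'a). norm x < 1"
    using eventually_nhds_in_open[of "ball (0 :: real^'a) 1" 0] by simp
  with C have "\<forall>\<^sub>F x in nhds 0. \<bar>f x\<bar> \<le> \<bar>C\<bar> * norm x ^ k"
  proof eventually_elim
    case (elim x)
    have "C * norm x ^ Suc k \<le> \<bar>C\<bar> * norm x ^ k"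
      using elim(2) power_Suc_le_self[of "norm x" k] mult_mono[of C "\<bar>C\<bar>" "norm x ^ Suc k" "norm x ^ k"]
      by (simp add: mult_left_le_one_le)
    with elim show ?case by simp
  qed
  then show "\<exists>C. \<forall>\<^sub>F x in nhds 0. \<bar>f x\<bar> \<le> C * norm x ^ k" ..
qed

text \<open>On the ray through \<open>x\<close> the left side scales with \<open>t ^ k\<close> and
  the bound with \<open>t ^ Suc k\<close>; divide by \<open>t ^ k\<close> and let \<open>t\<close>
  tend to zero.\<close>

lemma hom_germs_bigo_imp_0:
  assumes f: "f \<in> hom_germs k" and O: "germ_bigo (Suc k) f"
  shows "f = 0"
proof -
  obtain h where h: "smooth_near_0 h" "f = abs_germ h" "\<And>t x. h (t *\<^sub>R x) = t ^ k * h x"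
    using hom_germs_representative[OF f] by metis
  obtain C where C: "\<forall>\<^sub>F x in nhds 0. \<bar>h x\<bar> \<le> C * norm x ^ Suc k"
    using O h by (auto simp: germ_bigo_abs)
  have "h x = 0" for x
  proof -
    have "\<forall>\<^sub>F t in at_right 0. \<bar>h x\<bar> \<le> C * (t * norm x ^ Suc k)"
      using eventually_at_right_line[OF C, of x] eventually_at_right_less[of 0]
    proof eventually_elim
      case (elim t)
      then have "t ^ k * \<bar>h x\<bar> \<le> t ^ k * (C * (t * norm x ^ Suc k))"
        by (simp add: h(3) abs_mult power_mult_distrib mult_ac)
      then show ?case using elim(2) by (simp only: mult_le_cancel_left_pos zero_less_power)
    qed
    moreover have "((\<lambda>t. C * (t * norm x ^ Suc k)) \<longlongrightarrow> 0) (at_right 0)"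
      by (auto intro!: tendsto_eq_intros)
    ultimately have "\<bar>h x\<bar> \<le> 0"
      by (intro tendsto_lowerbound[where F = "at_right (0::real)"]) auto
    then show ?thesis by simp
  qed
  then have "h = (\<lambda>x. 0)" by auto
  then show ?thesis using h(2) by (simp add: zero_germ_def)
qed

text \<open>For the converse, degrees are peeled off one at a time: the degree \<open>k\<close>
  component of a germ bounded to order \<open>k + 1\<close> is itself so bounded, hence
  zero.\<close>

lemma order_ideal_iff_germ_bigo: "f \<in> order_ideal k \<longleftrightarrow> germ_bigo k f"
proof
  show "germ_bigo k f \<Longrightarrow> f \<in> order_ideal k"
  proof (induction k)
    case 0
    then show ?case by (simp add: order_ideal_0_eq_UNIV)
  next
    case (Suc k)
    then have f: "f \<in> order_ideal k" using germ_bigo_Suc_imp_germ_bigo by blast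
    have r: "f - taylor_component k f \<in> order_ideal (Suc k)"
      by (rule taylor_component_minus_in_order_ideal[OF f])
    then have "0 - (f - taylor_component k f) \<in> order_ideal (Suc k)" by (rule order_ideal_diff[OF zero_in_order_ideal])
    from germ_bigo_add[OF order_ideal_imp_germ_bigo[OF this] Suc.prems]
    have "germ_bigo (Suc k) (taylor_component k f)" by simp
    then have "taylor_component k f = 0" using hom_germs_bigo_imp_0 taylor_component_in_hom_germs by blast
    with r show ?case by simp
  qed
qed (rule order_ideal_imp_germ_bigo)

section \<open>Order and leading component under C^1 equivalence\<close>

lemma R_C1_equivalent_sym:
  assumes "R_C1_equivalent f g" shows "R_C1_equivalent g f"
  using assms
proof transfer
  fix f g :: "real^'a \<Rightarrow> real"
  assume "\<exists>\<phi>. C1_diffeo_germ \<phi> \<and> (\<forall>\<^sub>F x in nhds 0. f x = g (\<phi> x))"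
  then obtain \<phi> where \<phi>: "C1_diffeo_germ \<phi>" and fg: "\<forall>\<^sub>F x in nhds 0. f x = g (\<phi> x)" by blast
  then obtain U V \<psi> where UV: "\<phi> 0 = 0" "open U" "open V" "0 \<in> U" "homeomorphism U V \<phi> \<psi>"
    "C_k_on 1 \<phi> U" "C_k_on 1 \<psi> V" unfolding C1_diffeo_germ_def by blast
  have \<psi>: "\<psi> 0 = 0" "0 \<in> V" using UV by (auto simp: homeomorphism_def)
  then have \<psi>_diffeo: "C1_diffeo_germ \<psi>"
    unfolding C1_diffeo_germ_def using UV homeomorphism_symD by blast
  moreover have "\<forall>\<^sub>F y in nhds 0. f (\<psi> y) = g (\<phi> (\<psi> y))"
    using C1_diffeo_germ_tendsto[OF \<psi>_diffeo, unfolded filterlim_iff, rule_format, OF fg] .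
  then have "\<forall>\<^sub>F y in nhds 0. g y = f (\<psi> y)"
    using eventually_nhds_in_open[OF UV(3) \<psi>(2)]
    by eventually_elim (use UV(5) in \<open>simp add: homeomorphism_def\<close>)
  ultimately show "\<exists>\<phi>. C1_diffeo_germ \<phi> \<and> (\<forall>\<^sub>F x in nhds 0. g x = f (\<phi> x))" by blast
qed

lemma C1_diffeo_germ_derivative:
  assumes "C1_diffeo_germ \<phi>"
  obtains A B where "(\<phi> has_derivative (*v) A) (at 0)" "A ** B = mat 1" "B ** A = mat 1"
proof -
  obtain U V \<psi> where UV: "\<phi> 0 = 0" "open U" "open V" "0 \<in> U" "homeomorphism U V \<phi> \<psi>"
    "C_k_on 1 \<phi> U" "C_k_on 1 \<psi> V" using assms unfolding C1_diffeo_germ_def by blast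
  have \<psi>: "\<psi> 0 = 0" "0 \<in> V" using UV by (auto simp: homeomorphism_def)
  define A where "A = matrix (frechet_derivative \<phi> (at 0))"
  define B where "B = matrix (frechet_derivative \<psi> (at 0))"
  have d: "(\<phi> has_derivative frechet_derivative \<phi> (at 0)) (at 0)" "(\<psi> has_derivative frechet_derivative \<psi> (at 0)) (at 0)"
    using C_k_on_Suc_has_derivative[of 0] UV \<psi> by auto
  then have A: "(\<phi> has_derivative (*v) A) (at 0)" and B: "(\<psi> has_derivative (*v) B) (at 0)"
    unfolding A_def B_def using d by (simp_all add: matrix_vector_mul(2)[OF has_derivative_linear[OF d(1)]]
        matrix_vector_mul(2)[OF has_derivative_linear[OF d(2)]])
  have "((\<lambda>x. \<psi> (\<phi> x)) has_derivative (\<lambda>x. B *v (A *v x))) (at 0)"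
    by (rule has_derivative_compose[OF A]) (simp add: UV B)
  then have "((\<lambda>x. x) has_derivative (\<lambda>x. B *v (A *v x))) (at 0)"
    by (rule has_derivative_transform_within_open[OF _ UV(2,4)]) (use UV(5) in \<open>auto simp: homeomorphism_def\<close>)
  then have BA: "(\<lambda>x. B *v (A *v x)) = (\<lambda>x. x)" by (rule has_derivative_unique) (rule has_derivative_ident)
  have "((\<lambda>x. \<phi> (\<psi> x)) has_derivative (\<lambda>x. A *v (B *v x))) (at 0)"
    by (rule has_derivative_compose[OF B]) (simp add: \<psi> A)
  then have "((\<lambda>x. x) has_derivative (\<lambda>x. A *v (B *v x))) (at 0)"
    by (rule has_derivative_transform_within_open[OF _ UV(3) \<psi>(2)]) (use UV(5) in \<open>auto simp: homeomorphism_def\<close>)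
  then have AB: "(\<lambda>x. A *v (B *v x)) = (\<lambda>x. x)" by (rule has_derivative_unique) (rule has_derivative_ident)
  have "A ** B = mat 1" "B ** A = mat 1"
    using fun_cong[OF AB] fun_cong[OF BA] by (simp_all add: matrix_eq flip: matrix_vector_mul_assoc)
  with A that show thesis by blast
qed

lemma eventually_norm_le_of_has_derivative:
  fixes \<phi> :: "'a::real_normed_vector \<Rightarrow> 'b::real_normed_vector"
  assumes d: "(\<phi> has_derivative D) (at 0)" and \<phi>: "\<phi> 0 = 0"
  obtains C where "C \<ge> 0" "\<forall>\<^sub>F x in nhds 0. norm (\<phi> x) \<le> C * norm x"
proof -
  obtain K where K: "K > 0" "\<And>x. norm (D x) \<le> norm x * K"
    using bounded_linear.pos_bounded[OF has_derivative_bounded_linear[OF d]] by blast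
  have "\<forall>e>0. \<exists>d>0. \<forall>y. norm (y - 0) < d \<longrightarrow> norm (\<phi> y - \<phi> 0 - D (y - 0)) \<le> e * norm (y - 0)"
    using d by (simp add: has_derivative_at_alt)
  then obtain r where r: "r > 0" "\<And>y. norm y < r \<Longrightarrow> norm (\<phi> y - D y) \<le> norm y"
    using \<phi> by (metis diff_zero mult_1 zero_less_one)
  have "norm (\<phi> x) \<le> (1 + K) * norm x" if "norm x < r" for x
    using r(2)[OF that] K(2)[of x] norm_triangle_sub[of "\<phi> x" "D x"] by (simp add: algebra_simps)
  then have "\<forall>\<^sub>F x in nhds 0. norm (\<phi> x) \<le> (1 + K) * norm x"
    using eventually_nhds_in_open[of "ball 0 r" "0::'a"] r(1) by (auto elim!: eventually_mono)
  with K(1) show thesis by (intro that[of "1 + K"]) auto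
qed

lemma bigo_compose:
  assumes \<phi>: "filterlim \<phi> (nhds 0) (nhds 0)" "C \<ge> 0" "\<forall>\<^sub>F x in nhds 0. norm (\<phi> x) \<le> C * norm x"
    and g: "\<forall>\<^sub>F y in nhds 0. \<bar>g y\<bar> \<le> D * norm y ^ k"
  shows "\<forall>\<^sub>F x in nhds 0. \<bar>g (\<phi> x)\<bar> \<le> (\<bar>D\<bar> * C ^ k) * norm x ^ k"
proof -
  have "\<forall>\<^sub>F x in nhds 0. \<bar>g (\<phi> x)\<bar> \<le> D * norm (\<phi> x) ^ k"
    using \<phi>(1)[unfolded filterlim_iff, rule_format, OF g] .
  with \<phi>(3) show ?thesis
  proof eventually_elim
    case (elim x)
    have "D * norm (\<phi> x) ^ k \<le> \<bar>D\<bar> * (C * norm x) ^ k"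
      by (intro mult_mono power_mono elim) auto
    with elim show ?case by (simp add: power_mult_distrib mult.assoc)
  qed
qed

lemma R_C1_equivalent_order_ideal:
  assumes "R_C1_equivalent f g" "g \<in> order_ideal k"
  shows "f \<in> order_ideal k"
  using assms unfolding order_ideal_iff_germ_bigo
proof transfer
  fix f g :: "real^'a \<Rightarrow> real" and k
  assume "\<exists>\<phi>. C1_diffeo_germ \<phi> \<and> (\<forall>\<^sub>F x in nhds 0. f x = g (\<phi> x))"
    and "\<exists>D. \<forall>\<^sub>F y in nhds 0. \<bar>g y\<bar> \<le> D * norm y ^ k"
  then obtain \<phi> D where \<phi>: "C1_diffeo_germ \<phi>" and fg: "\<forall>\<^sub>F x in nhds 0. f x = g (\<phi> x)"
    and D: "\<forall>\<^sub>F y in nhds 0. \<bar>g y\<bar> \<le> D * norm y ^ k" by blast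
  obtain A where A: "(\<phi> has_derivative (*v) A) (at 0)" using C1_diffeo_germ_derivative[OF \<phi>] by blast
  obtain C where C: "C \<ge> 0" "\<forall>\<^sub>F x in nhds 0. norm (\<phi> x) \<le> C * norm x"
    using eventually_norm_le_of_has_derivative[OF A] \<phi> by (auto simp: C1_diffeo_germ_def)
  have "\<forall>\<^sub>F x in nhds 0. \<bar>f x\<bar> \<le> (\<bar>D\<bar> * C ^ k) * norm x ^ k"
    using fg bigo_compose[OF C1_diffeo_germ_tendsto[OF \<phi>] C D] by eventually_elim simp
  then show "\<exists>C. \<forall>\<^sub>F x in nhds 0. \<bar>f x\<bar> \<le> C * norm x ^ k" ..
qed

text \<open>Both leading components scale with \<open>t ^ d\<close> along a ray. With
  \<open>y t = \<phi> (t x) / t\<close>, which tends to \<open>A x\<close>, dividing by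
  \<open>t ^ d\<close> turns the comparison on small vectors into
  \<open>hf x = hg (y t) + O(t)\<close>, where only the derivative of \<phi> at \<open>0\<close>
  survives.\<close>

lemma R_C1_equivalent_leading_component:
  assumes fg: "R_C1_equivalent f g" and f: "f \<in> order_ideal d" and g: "g \<in> order_ideal d"
  obtains A B where "A ** B = mat 1" "B ** A = mat 1"
    "taylor_component d f = germ_linsubst A (taylor_component d g)"
proof -
  obtain F G where FG: "smooth_near_0 F" "f = abs_germ F" "smooth_near_0 G" "g = abs_germ G"
    using abs_germ_induct[of "\<lambda>f. \<exists>F. smooth_near_0 F \<and> f = abs_germ F"] by metis
  obtain hf where hf: "smooth_near_0 hf" "taylor_component d f = abs_germ hf"
    "\<And>t x. hf (t *\<^sub>R x) = t ^ d * hf x"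
    using hom_germs_representative[OF taylor_component_in_hom_germs] by metis
  obtain hg where hg: "smooth_near_0 hg" "taylor_component d g = abs_germ hg" "continuous_on UNIV hg"
    "\<And>t x. hg (t *\<^sub>R x) = t ^ d * hg x"
    using hom_germs_representative[OF taylor_component_in_hom_germs] by metis
  obtain \<phi> where \<phi>: "C1_diffeo_germ \<phi>" "\<forall>\<^sub>F x in nhds 0. F x = G (\<phi> x)"
    using fg FG by (auto simp: R_C1_equivalent.abs_eq germ_rel_def)
  obtain A B where AB: "(\<phi> has_derivative (*v) A) (at 0)" "A ** B = mat 1" "B ** A = mat 1"
    using C1_diffeo_germ_derivative[OF \<phi>(1)] .
  have \<phi>0: "\<phi> 0 = 0" using \<phi>(1) by (simp add: C1_diffeo_germ_def)
  obtain C where C: "C \<ge> 0" "\<forall>\<^sub>F x in nhds 0. norm (\<phi> x) \<le> C * norm x"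
    using eventually_norm_le_of_has_derivative[OF AB(1) \<phi>0] .
  have rem: "\<exists>C. \<forall>\<^sub>F x in nhds 0. \<bar>F x - h x\<bar> \<le> C * norm x ^ Suc d"
    if "abs_germ F \<in> order_ideal d" "smooth_near_0 F" "smooth_near_0 h" "taylor_component d (abs_germ F) = abs_germ h"
    for F h :: "real^'a \<Rightarrow> real"
    using order_ideal_imp_germ_bigo[OF taylor_component_minus_in_order_ideal[OF that(1)]] that(2-)
    by (simp add: minus_germ.abs_eq germ_rel_def germ_bigo_abs smooth_near_0_minus)
  obtain C1 where C1: "\<forall>\<^sub>F x in nhds 0. \<bar>F x - hf x\<bar> \<le> C1 * norm x ^ Suc d"
    using rem[of F hf] f FG hf by auto
  obtain C2 where C2: "\<forall>\<^sub>F x in nhds 0. \<bar>G x - hg x\<bar> \<le> C2 * norm x ^ Suc d"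
    using rem[of G hg] g FG hg by auto
  define D where "D = C1 + \<bar>C2\<bar> * C ^ Suc d"
  have D: "\<forall>\<^sub>F x in nhds 0. \<bar>hf x - hg (\<phi> x)\<bar> \<le> D * norm x ^ Suc d"
    using \<phi>(2) C1 bigo_compose[OF C1_diffeo_germ_tendsto[OF \<phi>(1)] C C2]
    by eventually_elim (simp add: D_def distrib_right)
  have "hf x = hg (A *v x)" for x
  proof -
    define y where "y t = (1 / t) *\<^sub>R \<phi> (t *\<^sub>R x)" for t :: real
    have "((\<lambda>t. \<phi> (t *\<^sub>R x)) has_derivative (\<lambda>t. A *v (t *\<^sub>R x))) (at 0)"
      by (rule has_derivative_compose[of "\<lambda>t. t *\<^sub>R x" "\<lambda>t. t *\<^sub>R x"])
         (auto intro!: derivative_eq_intros AB(1))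
    then have "((\<lambda>t. norm (\<phi> (t *\<^sub>R x) - t *\<^sub>R (A *v x)) / norm t) \<longlongrightarrow> 0) (at 0)"
      by (simp add: has_derivative_at \<phi>0 matrix_vector_mult_scaleR)
    then have lim: "((\<lambda>t. norm (\<phi> (t *\<^sub>R x) - t *\<^sub>R (A *v x)) / norm t) \<longlongrightarrow> 0) (at_right 0)"
      by (rule tendsto_mono[rotated]) (simp add: at_le)
    have pos: "\<forall>\<^sub>F t in at_right 0. t > (0::real)" by (simp add: eventually_at_right_less)
    have "((\<lambda>t. norm (y t - A *v x)) \<longlongrightarrow> 0) (at_right 0)"
    proof (rule Lim_transform_eventually[OF lim])
      show "\<forall>\<^sub>F t in at_right 0. norm (\<phi> (t *\<^sub>R x) - t *\<^sub>R (A *v x)) / norm t = norm (y t - A *v x)"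
        using pos
      proof eventually_elim
        case (elim t)
        then have "y t - A *v x = (1 / t) *\<^sub>R (\<phi> (t *\<^sub>R x) - t *\<^sub>R (A *v x))"
          by (simp add: y_def scaleR_diff_right)
        then show ?case using elim by simp
      qed
    qed
    then have y: "(y \<longlongrightarrow> A *v x) (at_right 0)"
      by (simp add: tendsto_norm_zero_iff LIM_zero_cancel)
    have "isCont hg (A *v x)" using hg(3) by (simp add: continuous_on_eq_continuous_at)
    then have "((\<lambda>t. hg (y t)) \<longlongrightarrow> hg (A *v x)) (at_right 0)"
      using y by (rule isCont_tendsto_compose)
    then have "((\<lambda>t. \<bar>hf x - hg (y t)\<bar>) \<longlongrightarrow> \<bar>hf x - hg (A *v x)\<bar>) (at_right 0)"
      by (intro tendsto_intros)
    moreover have "((\<lambda>t. D * (t * norm x ^ Suc d)) \<longlongrightarrow> 0) (at_right 0)"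
      by (auto intro!: tendsto_eq_intros)
    moreover have "\<forall>\<^sub>F t in at_right 0. \<bar>hf x - hg (y t)\<bar> \<le> D * (t * norm x ^ Suc d)"
      using eventually_at_right_line[OF D, of x] pos
    proof eventually_elim
      case (elim t)
      have "hg (\<phi> (t *\<^sub>R x)) = t ^ d * hg (y t)"
        using hg(4)[of t "y t"] elim by (simp add: y_def)
      then have "t ^ d * hf x - t ^ d * hg (y t) = hf (t *\<^sub>R x) - hg (\<phi> (t *\<^sub>R x))"
        by (simp add: hf(3))
      then have "t ^ d * \<bar>hf x - hg (y t)\<bar> = \<bar>hf (t *\<^sub>R x) - hg (\<phi> (t *\<^sub>R x))\<bar>"
        using elim by (simp flip: abs_mult right_diff_distrib \<open>t ^ d * hf x - t ^ d * hg (y t) = _\<close> add: abs_mult)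
      also have "\<dots> \<le> t ^ d * (D * (t * norm x ^ Suc d))"
        using elim by (simp add: power_mult_distrib mult_ac)
      finally show ?case using elim by (simp only: mult_le_cancel_left_pos zero_less_power)
    qed
    ultimately have "\<bar>hf x - hg (A *v x)\<bar> \<le> 0"
      by (intro tendsto_le[where F = "at_right (0::real)"]) auto
    then show ?thesis by simp
  qed
  then have "hf = (\<lambda>x. hg (A *v x))" by auto
  then have "taylor_component d f = germ_linsubst A (taylor_component d g)"
    using hf hg by (simp add: germ_linsubst.abs_eq germ_rel_def)
  with AB that show thesis by blast
qed

section \<open>Milnor numbers under linear changes of coordinates\<close>

lemma linsubst_jacobian_ideal:
  assumes BA: "A ** B = mat 1" and x: "x \<in> jacobian_ideal (germ_linsubst A f)"
  shows "germ_linsubst B x \<in> jacobian_ideal f"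
  using x unfolding jacobian_ideal_def
proof (induction rule: ideal_generated_induct)
  case (mult a x)
  then obtain i where "x = germ_partial i (germ_linsubst A f)" by blast
  then have "germ_linsubst B x = (\<Sum>j\<in>UNIV. A $ j $ i *\<^sub>R germ_partial j f)"
    by (simp add: germ_partial_linsubst germ_linsubst_sum germ_linsubst_scaleR germ_linsubst_linsubst
        BA germ_linsubst_id)
  then have "germ_linsubst B x \<in> ideal_generated (range (\<lambda>i. germ_partial i f))"
    by (simp add: ideal_generated_sum ideal_generated_scaleR ideal_generated_base)
  then show ?case by (simp add: germ_linsubst_mult ideal_generated_mult)
qed (auto simp: germ_linsubst_add ideal_generated_add)

text \<open>A linear isomorphism matching the subspaces carries bases of one quotient to bases of
  the other. An inequality is enough, since the inverse isomorphism gives the reverse one.\<close>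

lemma quotient_dim_le:
  assumes h: "linear h" "inj h" "surj h" and W: "\<And>x. h x \<in> W' \<longleftrightarrow> x \<in> W"
  shows "quotient_dim W' \<le> quotient_dim W"
proof -
  have "quotient_basis W' (h ` B) \<and> card (h ` B) = card B" if B: "quotient_basis W B" for B
  proof -
    have inj: "inj_on h B" using h(2) by (rule inj_on_subset) simp
    have sum: "(\<Sum>b\<in>h ` B. c b *\<^sub>R b) = h (\<Sum>b\<in>B. c (h b) *\<^sub>R b)" for c
      by (simp add: sum.reindex[OF inj] linear_sum[OF h(1)] linear_scale[OF h(1)])
    have "\<exists>c. v - (\<Sum>b\<in>h ` B. c b *\<^sub>R b) \<in> W'" for v
    proof -
      obtain u where u: "v = h u" using h(3) by blast
      obtain c where c: "u - (\<Sum>b\<in>B. c b *\<^sub>R b) \<in> W" using B unfolding quotient_basis_def by blast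
      have "h (\<Sum>b\<in>B. (c \<circ> inv h) (h b) *\<^sub>R b) = h (\<Sum>b\<in>B. c b *\<^sub>R b)"
        using h(2) by simp
      then have "v - (\<Sum>b\<in>h ` B. (c \<circ> inv h) b *\<^sub>R b) = h (u - (\<Sum>b\<in>B. c b *\<^sub>R b))"
        unfolding sum by (simp add: u linear_diff[OF h(1)])
      with c W show ?thesis by metis
    qed
    with B W show ?thesis
      unfolding quotient_basis_def sum by (fastforce simp: card_image[OF inj])
  qed
  then show ?thesis
    unfolding quotient_dim_def by (intro Inf_superset_mono) force
qed

lemma milnor_number_linsubst:
  assumes "A ** B = mat 1" "B ** A = mat 1"
  shows "milnor_number (germ_linsubst A f) = milnor_number f"
proof -
  have le: "milnor_number (germ_linsubst A f) \<le> milnor_number f"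
    if AB: "A ** B = mat 1" "B ** A = mat 1" for A B :: "real^'a^'a" and f
    unfolding milnor_number_def
  proof (rule quotient_dim_le)
    have inv: "germ_linsubst A (germ_linsubst B x) = x" "germ_linsubst B (germ_linsubst A x) = x" for x
      by (simp_all add: germ_linsubst_linsubst AB germ_linsubst_id)
    show "linear (germ_linsubst A)"
      by (rule linearI) (simp_all add: germ_linsubst_add germ_linsubst_scaleR)
    show "inj (germ_linsubst A)" "surj (germ_linsubst A)"
      using inv by (metis injI, metis surjI)
    show "germ_linsubst A x \<in> jacobian_ideal (germ_linsubst A f) \<longleftrightarrow> x \<in> jacobian_ideal f" for x
      using linsubst_jacobian_ideal[OF AB(1), of "germ_linsubst A x" f]
        linsubst_jacobian_ideal[OF AB(2), of x "germ_linsubst A f"] by (auto simp: inv)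
  qed
  show ?thesis
    using le[OF assms, of f] le[OF assms(2,1), of "germ_linsubst A f"]
    by (simp add: germ_linsubst_linsubst assms germ_linsubst_id)
qed

lemma milnor_number_eq_leading_component:
  assumes f: "f \<in> order_ideal d" and d: "d > 0" and fin: "milnor_number (taylor_component d f) < \<infinity>"
  shows "milnor_number f = milnor_number (taylor_component d f)"
proof -
  obtain B where B: "quotient_basis (jacobian_ideal (taylor_component d f)) B"
    using fin unfolding milnor_number_def quotient_dim_def
    by (cases "\<exists>B. quotient_basis (jacobian_ideal (taylor_component d f)) B") (auto simp: top_enat_def)
  interpret initial_forms "\<lambda>i. germ_partial i (taylor_component d f)" "\<lambda>i. germ_partial i f" "d - 1"
  proof
    fix i
    show "germ_partial i (taylor_component d f) \<in> hom_germs (d - 1)"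
      by (rule germ_partial_hom_germs[OF taylor_component_in_hom_germs])
    \<comment> \<open>Differentiation lowers the order from \<open>d + 1\<close> to
      \<open>d\<close>, which equals \<open>Suc (d - 1)\<close> because \<open>d\<close> is
      positive.\<close>
    show "germ_partial i f - germ_partial i (taylor_component d f) \<in> order_ideal (Suc (d - 1))"
      using germ_partial_order_ideal[OF taylor_component_minus_in_order_ideal[OF f], of i] d
      by (simp add: germ_partial_minus)
  qed
  show ?thesis
    using quotient_dim_eq B by (simp add: milnor_number_def jacobian_ideal_def)
qed

theorem theorem5p1:
  fixes f g :: "'n::finite germ"
  assumes "germ_value f = 0" and "germ_value g = 0"
    and "taylor_nonzero f"
    and "alg_isolated_singularity (initial_part f)"
    and "R_C1_equivalent f g"
  shows "milnor_number f = milnor_number g"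
proof -
  define d where "d = (LEAST d. taylor_component d f \<noteq> 0)"
  have f: "f \<in> order_ideal d" unfolding order_ideal_iff d_def using not_less_Least by blast
  then have g: "g \<in> order_ideal d"
    by (rule R_C1_equivalent_order_ideal[OF R_C1_equivalent_sym[OF assms(5)]])
  have "taylor_component d f \<noteq> 0"
    using assms(3) unfolding d_def taylor_nonzero_def by (rule LeastI_ex)
  then have d: "d > 0" using assms(1) by (cases d) (auto simp: taylor_component_0)
  have fin: "milnor_number (taylor_component d f) < \<infinity>"
    using assms(4) by (simp add: alg_isolated_singularity_def initial_part_def d_def)
  obtain A B where "A ** B = mat 1" "B ** A = mat 1"
    "taylor_component d f = germ_linsubst A (taylor_component d g)"
    using R_C1_equivalent_leading_component[OF assms(5) f g] .
  \<comment> \<open>Hence the degree \<open>d\<close> component of \<open>g\<close> has finite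
    Milnor number too, and \<open>milnor_number_eq_leading_component\<close> applies to
    \<open>g\<close> with the \<open>d\<close> found for \<open>f\<close>.\<close>
  then have "milnor_number (taylor_component d f) = milnor_number (taylor_component d g)"
    using milnor_number_linsubst by metis
  then show ?thesis
    using milnor_number_eq_leading_component[OF f d] milnor_number_eq_leading_component[OF g d] fin by simp
qed

end
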